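(* Let $d,p\ge 1$, let $\mathbf{x}^*\in\mathbb{R}^d$, let $\mathbf{K},\mathbf{D}\in\mathbb{R}^{d\times d}$ be symmetric positive definite matrices, and let $\psi(\cdot\,;\mathbf{w}):\mathbb{R}^d\to\mathbb{R}$ be a family of smooth functions parametrized by $\mathbf{w}\in\mathbb{R}^p$. Let $\mathbf{w}\in\mathbb{R}^p$ be arbitrary, let $\mathbf{G}(\mathbf{x};\mathbf{w})=\mathbf{I}+\nabla\psi(\mathbf{x};\mathbf{w})\nabla\psi(\mathbf{x};\mathbf{w})^T$, and let $\boldsymbol{\Xi}(\mathbf{x},\dot{\mathbf{x}};\mathbf{w})$ be the matrix of Christoffel symbols of the metric $\mathbf{G}(\cdot\,;\mathbf{w})$ contracted with the velocity $\dot{\mathbf{x}}$. Then the dynamical system on $\mathbb{R}^d$ $$\ddot{\mathbf{x}} = -\mathbf{G}^{-1}(\mathbf{x};\mathbf{w})\left(\mathbf{K}(\mathbf{x}-\mathbf{x}^* )+\mathbf{D}\dot{\mathbf{x}}\right)-\boldsymbol{\Xi}(\mathbf{x},\dot{\mathbf{x}};\mathbf{w})\,\dot{\mathbf{x}}$$ is globally asymptotically stable at the attractor $\mathbf{x}^*$, i.e. for every initial condition $(\mathbf{x}(0),\dot{\mathbf{x}}(0))\in\mathbb{R}^d\times\mathbb{R}^d$ the corresponding solution is defined for all $t\ge 0$ and satisfies $\lim_{t\to\infty}\|\mathbf{x}(t)-\mathbf{x}^*\|=0$.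
   Context: All gradients and partial derivatives of $\psi$ are with respect to $\mathbf{x}=(x^1,\dots,x^d)$; $\partial_i=\partial/\partial x^i$, and $\nabla\psi=[\partial_1\psi,\dots,\partial_d\psi]^T$ is a column vector. The matrix field $\mathbf{G}(\mathbf{x};\mathbf{w})=\mathbf{I}+\nabla\psi\nabla\psi^T$, with entries $g_{ij}=\delta_{ij}+\partial_i\psi\,\partial_j\psi$, is the pullback of the Euclidean metric of $\mathbb{R}^{d+1}$ under the map $\mathbf{x}\mapsto(\mathbf{x},\psi(\mathbf{x};\mathbf{w}))$; $g^{ij}$ denotes the entries of $\mathbf{G}^{-1}$. The matrix $\boldsymbol{\Xi}(\mathbf{x},\dot{\mathbf{x}};\mathbf{w})$ has entries (row $q$, column $j$; summation over repeated indices $i,m\in\{1,\dots,d\}$) $$\Xi^q_j=\tfrac12\, g^{qm}\Big(\partial_i(\partial_m\psi\,\partial_j\psi)+\partial_j(\partial_m\psi\,\partial_i\psi)-\partial_m(\partial_i\psi\,\partial_j\psi)\Big)\dot{x}^i,$$ that is, $\Xi^q_j=\Gamma^q_{ij}\dot{x}^i$ where $\Gamma^q_{ij}=\tfrac12 g^{qm}(\partial_i g_{mj}+\partial_j g_{mi}-\partial_m g_{ij})$ are the Christoffel symbols of the Levi-Civita connection of $g$. *)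

theory Defs
  imports "HOL-Analysis.Analysis"
begin

definition partial_deriv :: "'n::finite \<Rightarrow> (real^'n \<Rightarrow> real) \<Rightarrow> real^'n \<Rightarrow> real" where
  "partial_deriv i f x = deriv (\<lambda>t. f (x + t *\<^sub>R axis i 1)) 0"

definition grad :: "(real^'n::finite \<Rightarrow> real) \<Rightarrow> real^'n \<Rightarrow> real^'n" where
  "grad f x = (\<chi> i. partial_deriv i f x)"

text \<open>Since \<^const>\<open>partial_deriv\<close> is total (it has an unspecified value where the derivative does
  not exist), differentiability is required explicitly at every order.\<close>

primrec k_times_cont_diff :: "nat \<Rightarrow> (real^'n::finite \<Rightarrow> real) \<Rightarrow> bool" where
  "k_times_cont_diff 0 f \<longleftrightarrow> continuous_on UNIV f"
| "k_times_cont_diff (Suc k) f \<longleftrightarrow>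
     (\<forall>x. f differentiable (at x)) \<and> (\<forall>i. k_times_cont_diff k (partial_deriv i f))"

definition smooth :: "(real^'n::finite \<Rightarrow> real) \<Rightarrow> bool" where
  "smooth f \<longleftrightarrow> (\<forall>k. k_times_cont_diff k f)"

definition sym_pos_def :: "real^'n^'n::finite \<Rightarrow> bool" where
  "sym_pos_def A \<longleftrightarrow> transpose A = A \<and> (\<forall>x. x \<noteq> 0 \<longrightarrow> x \<bullet> (A *v x) > 0)"

definition graph_metric :: "(real^'n::finite \<Rightarrow> real) \<Rightarrow> real^'n \<Rightarrow> real^'n^'n" where
  "graph_metric f x = mat 1 + (columnvector (grad f x) :: real^1^'n) ** rowvector (grad f x)"

text \<open>\<open>christoffel g q i j\<close> is the symbol with upper index \<open>q\<close> and lower indices \<open>i\<close>, \<open>j\<close>.\<close>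

definition christoffel ::
  "(real^'n::finite \<Rightarrow> real^'n^'n) \<Rightarrow> 'n \<Rightarrow> 'n \<Rightarrow> 'n \<Rightarrow> real^'n \<Rightarrow> real" where
  "christoffel g q i j x =
     1/2 * (\<Sum>m\<in>UNIV. matrix_inv (g x) $ q $ m *
       (partial_deriv i (\<lambda>y. g y $ m $ j) x
        + partial_deriv j (\<lambda>y. g y $ m $ i) x
        - partial_deriv m (\<lambda>y. g y $ i $ j) x))"

definition christoffel_matrix ::
  "(real^'n::finite \<Rightarrow> real^'n^'n) \<Rightarrow> real^'n \<Rightarrow> real^'n \<Rightarrow> real^'n^'n" where
  "christoffel_matrix g x v = (\<chi> q j. \<Sum>i\<in>UNIV. christoffel g q i j x * v $ i)"

definition accel ::
  "real^'n^'n \<Rightarrow> real^'n^'n \<Rightarrow> real^'n \<Rightarrow> (real^'n::finite \<Rightarrow> real) \<Rightarrow> real^'n \<Rightarrow> real^'n \<Rightarrow> real^'n" where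
  "accel K D xstar f x v =
     - (matrix_inv (graph_metric f x) *v (K *v (x - xstar) + D *v v))
     - christoffel_matrix (graph_metric f) x v *v v"

definition second_order_solution ::
  "('a::real_normed_vector \<Rightarrow> 'a \<Rightarrow> 'a) \<Rightarrow> real set \<Rightarrow> 'a \<Rightarrow> 'a \<Rightarrow> (real \<Rightarrow> 'a) \<Rightarrow> bool" where
  "second_order_solution F J x0 v0 x \<longleftrightarrow>
     (\<exists>v. x 0 = x0 \<and> v 0 = v0 \<and>
        (\<forall>t\<in>J. (x has_vector_derivative v t) (at t within J) \<and>
               (v has_vector_derivative F (x t) (v t)) (at t within J)))"

text \<open>Global asymptotic stability means here that the solution through every initial condition
  exists for all nonnegative times and its position tends to the attractor; no separate condition of
  Lyapunov stability is imposed. The clause on \<open>y\<close> says that \<open>x\<close> is the only solution with its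
  initial condition, also among those defined only on a shorter time interval.\<close>

definition globally_asymptotically_stable ::
  "('a::real_normed_vector \<Rightarrow> 'a \<Rightarrow> 'a) \<Rightarrow> 'a \<Rightarrow> bool" where
  "globally_asymptotically_stable F xstar \<longleftrightarrow>
     (\<forall>x0 v0. \<exists>x. second_order_solution F {0..} x0 v0 x \<and>
        (\<forall>T>0. \<forall>y. second_order_solution F {0..<T} x0 v0 y \<longrightarrow> (\<forall>t\<in>{0..<T}. y t = x t)) \<and>
        ((\<lambda>t. norm (x t - xstar)) \<longlongrightarrow> 0) at_top)"

lemma graph_metric_nth:
  "graph_metric f x $ i $ j
     = (if i = j then 1 else 0) + partial_deriv i f x * partial_deriv j f x"
  by (simp add: graph_metric_def mat_def matrix_matrix_mult_def columnvector_def rowvector_def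
      grad_def)

lemma partial_deriv_const_add: "partial_deriv i (\<lambda>y. c + f y) x = partial_deriv i f x"
proof -
  have "((\<lambda>t. c + f (x + t *\<^sub>R axis i 1)) has_field_derivative D) (at 0)
      \<longleftrightarrow> ((\<lambda>t. f (x + t *\<^sub>R axis i 1)) has_field_derivative D) (at 0)" for D
    using DERIV_add[OF DERIV_const[of c], of "\<lambda>t. f (x + t *\<^sub>R axis i 1)" D 0 UNIV]
      DERIV_add[OF DERIV_const[of "- c"], of "\<lambda>t. c + f (x + t *\<^sub>R axis i 1)" D 0 UNIV]
    by auto
  then show ?thesis
    by (simp add: partial_deriv_def deriv_def)
qed

lemma christoffel_matrix_graph_metric_nth:
  "christoffel_matrix (graph_metric f) x v $ q $ j =
     (\<Sum>i\<in>UNIV. 1/2 * (\<Sum>m\<in>UNIV. matrix_inv (graph_metric f x) $ q $ m *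
       (partial_deriv i (\<lambda>y. partial_deriv m f y * partial_deriv j f y) x
        + partial_deriv j (\<lambda>y. partial_deriv m f y * partial_deriv i f y) x
        - partial_deriv m (\<lambda>y. partial_deriv i f y * partial_deriv j f y) x)) * v $ i)"
  by (simp add: christoffel_matrix_def christoffel_def graph_metric_nth partial_deriv_const_add)

end

theory Submission
  imports Defs
begin

text \<open>Write \<open>e = x - x*\<close>. Multiplied by the metric, the system reads
  \<open>G a = - (K e + D v + c(x, v))\<close>, where \<open>c\<close> collects the Christoffel symbols of the first kind and
  satisfies \<open>v \<bullet> c = 1/2 v \<bullet> G' v\<close>, with \<open>G'\<close> the derivative of the metric along the motion. Hence the
  energy \<open>V = 1/2 v \<bullet> G v + 1/2 e \<bullet> K e\<close> has derivative \<open>- v \<bullet> D v\<close>; since \<open>G \<ge> I\<close>, it bounds position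
  and velocity, so solutions exist for all times. Instead of an invariance principle, convergence uses
  the strict Lyapunov function \<open>V + \<epsilon> e \<bullet> G v\<close>: on the bounded set visited by a solution, all terms
  of its derivative other than \<open>- v \<bullet> D v - \<epsilon> e \<bullet> K e\<close> are at most a multiple of
  \<open>\<epsilon> (|v|^2 + |e| |v|)\<close>, so for small \<open>\<epsilon>\<close> it decays exponentially.\<close>

subsection \<open>Global solutions of ordinary differential equations\<close>

text \<open>The Picard iterates started at the constant \<open>z0\<close> converge uniformly on
  every bounded interval, and the integral equation passes to the limit because \<open>F\<close> is
  uniformly continuous.\<close>

lemma picard_iteration_global:
  fixes F :: "'a::banach \<Rightarrow> 'a"
  assumes lip: "L-lipschitz_on UNIV F"
  shows "\<exists>z. z 0 = z0 \<and> (\<forall>t\<ge>0. (z has_vector_derivative F (z t)) (at t within {0..}))"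
proof -
  \<comment> \<open>Unlike \<open>L\<close>, the constant \<open>M\<close> cannot vanish, so it can
    be divided by.\<close>
  define M where "M = L + 1"
  have M: "M > 0" using lipschitz_on_nonneg[OF lip] by (simp add: M_def)
  have lipM: "norm (F x - F y) \<le> M * norm (x - y)" for x y
  proof -
    have "norm (F x - F y) \<le> L * norm (x - y)"
      by (rule lipschitz_on_normD[OF lip]) auto
    also have "\<dots> \<le> M * norm (x - y)" by (simp add: M_def mult_right_mono)
    finally show ?thesis .
  qed
  have contF: "continuous_on S F" for S
    using lipschitz_on_continuous_on[OF lip] continuous_on_subset by blast
  define \<phi> where "\<phi> = (\<lambda>n. ((\<lambda>g t. z0 + integral {0..t} (\<lambda>s. F (g s))) ^^ n) (\<lambda>_::real. z0))"
  have phi0: "\<phi> 0 = (\<lambda>_. z0)" by (simp add: \<phi>_def)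
  have phiS: "\<phi> (Suc n) = (\<lambda>t. z0 + integral {0..t} (\<lambda>s. F (\<phi> n s)))" for n
    by (simp add: \<phi>_def)
  have cont: "continuous_on {0..T} (\<phi> n)" for n T
  proof (induction n)
    case 0 show ?case by (simp add: phi0)
  next
    case (Suc n)
    have "continuous_on {0..T} (\<lambda>s. F (\<phi> n s))"
      using continuous_on_compose2[OF contF[of UNIV] Suc] by auto
    then show ?case
      unfolding phiS
      by (intro continuous_intros indefinite_integral_continuous_1 integrable_continuous_real)
  qed
  have contFphi: "continuous_on {0..T} (\<lambda>s. F (\<phi> n s))" for n T
    using continuous_on_compose2[OF contF[of UNIV] cont] by auto
  \<comment> \<open>\<open>C\<close> makes \<open>t * norm (F z0)\<close> equal to
    \<open>C * (2 * M * t)\<close>, which the exponential dominates; this starts the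
    induction.\<close>
  define C where "C = norm (F z0) / (2 * M)"
  have C: "C \<ge> 0" using M by (simp add: C_def)
  txt \<open>With the weight \<open>exp (2 M t)\<close>, an iteration halves the distance for all times at once, so that no
    local solutions have to be glued.\<close>
  have step: "norm (\<phi> (Suc n) t - \<phi> n t) \<le> C * (1/2)^n * exp (2 * M * t)" if "t \<ge> 0" for n t
    using that
  proof (induction n arbitrary: t)
    case 0
    have "norm (\<phi> (Suc 0) t - \<phi> 0 t) = t * norm (F z0)"
      using 0 by (simp add: phi0 phiS)
    also have "\<dots> = C * (2 * M * t)" using M by (simp add: C_def)
    also have "\<dots> \<le> C * exp (2 * M * t)"
      using C exp_ge_add_one_self[of "2 * M * t"] by (intro mult_left_mono) linarith+
    finally show ?case by simp
  next
    case (Suc n)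
    have int: "(\<lambda>s. F (\<phi> k s)) integrable_on {0..t}" for k
      by (rule integrable_continuous_real[OF contFphi])
    \<comment> \<open>\<open>E\<close> is the bound to be proved. Its derivative is \<open>M\<close>
      times the previous bound: the rate \<open>2 * M\<close> of the exponential pays both for the
      Lipschitz constant and for the new factor 1/2.\<close>
    define E where "E = (\<lambda>s. C * (1/2)^Suc n * exp (2 * M * s))"
    have E: "((\<lambda>s. M * (C * (1/2)^n * exp (2 * M * s))) has_integral (E t - E 0)) {0..t}"
      unfolding E_def using Suc.prems
      by (intro fundamental_theorem_of_calculus)
        (auto simp flip: has_real_derivative_iff_has_vector_derivative intro!: derivative_eq_intros)
    have "norm (\<phi> (Suc (Suc n)) t - \<phi> (Suc n) t)
        = norm (integral {0..t} (\<lambda>s. F (\<phi> (Suc n) s) - F (\<phi> n s)))"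
      by (subst integral_diff[OF int int]) (simp add: phiS)
    also have "\<dots> \<le> integral {0..t} (\<lambda>s. M * (C * (1/2)^n * exp (2 * M * s)))"
    proof (rule integral_norm_bound_integral)
      fix s assume "s \<in> {0..t}"
      then have "norm (\<phi> (Suc n) s - \<phi> n s) \<le> C * (1/2)^n * exp (2 * M * s)"
        using Suc.IH by simp
      then show "norm (F (\<phi> (Suc n) s) - F (\<phi> n s)) \<le> M * (C * (1/2)^n * exp (2 * M * s))"
        using lipM M by (meson mult_left_mono less_imp_le order_trans)
    qed (use E int in \<open>auto intro!: integrable_diff\<close>)
    also have "\<dots> = E t - E 0" using E by (rule integral_unique)
    also have "\<dots> \<le> E t" using C by (simp add: E_def)
    finally show ?case by (simp add: E_def)
  qed
  \<comment> \<open>Written as a telescoping series, the limit falls under the Weierstrass M-test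
    with a geometric majorant.\<close>
  define z where "z = (\<lambda>t. z0 + (\<Sum>i. \<phi> (Suc i) t - \<phi> i t))"
  have unif: "uniform_limit {0..T} \<phi> z sequentially" for T
  proof -
    have "norm (\<phi> (Suc n) t - \<phi> n t) \<le> (C * exp (2 * M * T)) * (1/2)^n" if "t \<in> {0..T}" for n t
    proof -
      have "norm (\<phi> (Suc n) t - \<phi> n t) \<le> C * (1/2)^n * exp (2 * M * t)"
        using step that by simp
      also have "\<dots> \<le> C * (1/2)^n * exp (2 * M * T)"
        using that C M by (intro mult_left_mono) auto
      finally show ?thesis by (simp add: mult_ac)
    qed
    then have "uniform_limit {0..T} (\<lambda>n t. \<Sum>i<n. \<phi> (Suc i) t - \<phi> i t)
        (\<lambda>t. \<Sum>i. \<phi> (Suc i) t - \<phi> i t) sequentially"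
      by (rule Weierstrass_m_test) (auto intro!: summable_mult summable_geometric)
    then have "uniform_limit {0..T} (\<lambda>n t. z0 + (\<Sum>i<n. \<phi> (Suc i) t - \<phi> i t)) z sequentially"
      unfolding z_def by (intro uniform_limit_intros)
    moreover have "(\<lambda>n t. z0 + (\<Sum>i<n. \<phi> (Suc i) t - \<phi> i t)) = \<phi>"
      by (simp add: fun_eq_iff sum_lessThan_telescope[of "\<lambda>i. \<phi> i t" for t] phi0)
    ultimately show ?thesis by simp
  qed
  have contz: "continuous_on {0..T} z" for T
    by (rule uniform_limit_theorem[OF _ unif]) (auto simp: cont)
  have contFz: "continuous_on {0..T} (\<lambda>s. F (z s))" for T
    using continuous_on_compose2[OF contF[of UNIV] contz] by auto
  have unifF: "uniform_limit {0..T} (\<lambda>n s. F (\<phi> n s)) (\<lambda>s. F (z s)) sequentially" for T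
    using uniform_limit_compose_uniformly_continuous_on[OF unif lipschitz_on_uniformly_continuous[OF lip]]
    by auto
  have z_eq: "z t = z0 + integral {0..t} (\<lambda>s. F (z s))" if "t \<ge> 0" for t
  proof -
    obtain I J where I: "\<And>n. ((\<lambda>s. F (\<phi> n s)) has_integral I n) {0..t}"
      and J: "((\<lambda>s. F (z s)) has_integral J) {0..t}" and IJ: "I \<longlonglongrightarrow> J"
      by (rule uniform_limit_integral[OF unifF contFphi]) auto
    have "(\<lambda>n. z0 + I n) \<longlonglongrightarrow> z0 + J" by (intro tendsto_intros IJ)
    moreover have "(\<lambda>n. z0 + I n) = (\<lambda>n. \<phi> (Suc n) t)"
      using I by (auto simp: phiS fun_eq_iff intro!: integral_unique[symmetric])
    moreover have "(\<lambda>n. \<phi> (Suc n) t) \<longlonglongrightarrow> z t"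
      by (intro LIMSEQ_Suc tendsto_uniform_limitI[OF unif[of t]]) (use that in auto)
    ultimately show ?thesis using J by (metis LIMSEQ_unique integral_unique)
  qed
  show ?thesis
  proof (intro exI[of _ z] conjI allI impI)
    show "z 0 = z0" using z_eq[of 0] by simp
    fix t :: real assume t: "t \<ge> 0"
    \<comment> \<open>The fundamental theorem is applied on an interval reaching beyond
      \<open>t\<close>, so that the derivative within it is the one within the half-line.\<close>
    have "((\<lambda>u. z0 + integral {0..u} (\<lambda>s. F (z s))) has_vector_derivative F (z t))
        (at t within {0..t+1})"
      by (rule derivative_eq_intros integral_has_vector_derivative contFz refl)+ (use t in auto)
    then have "(z has_vector_derivative F (z t)) (at t within {0..t+1})"
      by (rule has_vector_derivative_transform[rotated 2]) (use t z_eq in auto)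
    moreover have "at t within {0..t+1} = at t within {0..}"
      by (rule at_within_nhd[where S="{t - 1 <..< t + 1}"]) auto
    ultimately show "(z has_vector_derivative F (z t)) (at t within {0..})" by simp
  qed
qed

lemma nonincreasing_if_derivative_nonpos_within:
  fixes f :: "real \<Rightarrow> real"
  assumes "a \<le> b"
    and der: "\<And>t. t \<in> {a..b} \<Longrightarrow> (f has_vector_derivative f' t) (at t within {a..b})"
    and "\<And>t. t \<in> {a..b} \<Longrightarrow> f' t \<le> 0"
  shows "f b \<le> f a"
proof (cases "a = b")
  case False
  then have ab: "a < b" using assms(1) by simp
  have "\<exists>t\<in>{a<..<b}. f b - f a = (b - a) *\<^sub>R f' t"
    by (rule mvt_simple[OF ab]) (use der in \<open>auto simp: has_vector_derivative_def\<close>)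
  then obtain t where t: "t \<in> {a<..<b}" "f b - f a = (b - a) * f' t" by auto
  then have "(b - a) * f' t \<le> 0"
    using assms(3)[of t] ab by (intro mult_nonneg_nonpos) auto
  then show ?thesis using t by simp
qed simp

text \<open>Gronwall's argument: the squared distance weighted by \<open>exp (- 2 * L * t)\<close>
  cannot increase and starts at 0. The inner product keeps the squared distance differentiable even
  where the solutions meet.\<close>

lemma ode_solution_unique_Icc:
  fixes f :: "'a::real_inner \<Rightarrow> 'a"
  assumes lip: "L-lipschitz_on X f" and T: "0 \<le> T" and "y 0 = z 0"
    and y: "\<And>t. t \<in> {0..T} \<Longrightarrow> (y has_vector_derivative f (y t)) (at t within {0..T})"
    and z: "\<And>t. t \<in> {0..T} \<Longrightarrow> (z has_vector_derivative f (z t)) (at t within {0..T})"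
    and X: "\<And>t. t \<in> {0..T} \<Longrightarrow> y t \<in> X \<and> z t \<in> X"
  shows "y T = z T"
proof -
  define u where "u = (\<lambda>t. ((y t - z t) \<bullet> (y t - z t)) * exp (- 2 * L * t))"
  define u' where "u' = (\<lambda>t. (2 * ((y t - z t) \<bullet> (f (y t) - f (z t)))
      - 2 * L * ((y t - z t) \<bullet> (y t - z t))) * exp (- 2 * L * t))"
  have "u T \<le> u 0"
  proof (rule nonincreasing_if_derivative_nonpos_within[OF T])
    fix t assume t: "t \<in> {0..T}"
    have d: "((\<lambda>t. (y t - z t) \<bullet> (y t - z t)) has_vector_derivative
       ((y t - z t) \<bullet> (f (y t) - f (z t)) + (f (y t) - f (z t)) \<bullet> (y t - z t))) (at t within {0..T})"
      by (intro bounded_bilinear.has_vector_derivative[OF bounded_bilinear_inner]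
          has_vector_derivative_diff y z t)
    have e: "((\<lambda>t. exp (- 2 * L * t)) has_vector_derivative (- 2 * L * exp (- 2 * L * t)))
       (at t within {0..T})"
      by (auto simp flip: has_real_derivative_iff_has_vector_derivative intro!: derivative_eq_intros)
    show "(u has_vector_derivative u' t) (at t within {0..T})"
      unfolding u_def u'_def
      by (rule has_vector_derivative_eq_rhs[OF has_vector_derivative_mult[OF d e]])
        (simp add: algebra_simps inner_commute)
    have "(y t - z t) \<bullet> (f (y t) - f (z t)) \<le> norm (y t - z t) * (L * norm (y t - z t))"
      using norm_cauchy_schwarz[of "y t - z t" "f (y t) - f (z t)"]
        lipschitz_on_normD[OF lip, of "y t" "z t"] X[OF t]
      by (meson mult_left_mono norm_ge_zero order_trans)
    also have "\<dots> = L * ((y t - z t) \<bullet> (y t - z t))"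
      by (simp add: dot_square_norm power2_eq_square)
    finally show "u' t \<le> 0"
      unfolding u'_def by (intro mult_nonpos_nonneg) auto
  qed
  also have "u 0 = 0" using \<open>y 0 = z 0\<close> by (simp add: u_def)
  finally have "(y T - z T) \<bullet> (y T - z T) \<le> 0" by (simp add: u_def mult_le_0_iff)
  then show ?thesis by (metis inner_gt_zero_iff linorder_not_le right_minus_eq)
qed

text \<open>The a-priori bound \<open>R\<close> is uniform in \<open>T\<close> and so excludes
  blow-up; a Lipschitz condition on balls then suffices for a global solution.\<close>

theorem ode_global_solution_if_bounded:
  fixes f :: "'a::euclidean_space \<Rightarrow> 'a"
  assumes lip: "\<And>r. \<exists>L. L-lipschitz_on (cball 0 r) f"
    and bound: "\<And>T z. 0 \<le> T \<Longrightarrow> z 0 = z0 \<Longrightarrow>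
      (\<And>t. t \<in> {0..T} \<Longrightarrow> (z has_vector_derivative f (z t)) (at t within {0..T})) \<Longrightarrow> norm (z T) \<le> R"
  obtains z where "z 0 = z0"
    and "\<forall>t\<ge>0. (z has_vector_derivative f (z t)) (at t within {0..})"
    and "\<forall>T y. y 0 = z0 \<longrightarrow>
      (\<forall>t\<in>{0..<T}. (y has_vector_derivative f (y t)) (at t within {0..<T})) \<longrightarrow>
      (\<forall>t\<in>{0..<T}. y t = z t)"
proof -
  \<comment> \<open>For \<open>T = 0\<close> the derivative condition lives on a single point, where
    any curve meets it; the a-priori bound thus covers the initial value.\<close>
  have z0: "norm z0 \<le> R"
  proof -
    have "((\<lambda>t. z0 + t *\<^sub>R f z0) has_vector_derivative f z0) (at 0 within {0})"
      unfolding has_vector_derivative_def by (auto intro!: derivative_eq_intros)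
    then show ?thesis using bound[of 0 "\<lambda>t. z0 + t *\<^sub>R f z0"] by simp
  qed
  \<comment> \<open>The margin 1 beyond \<open>R\<close> yields the contradiction below: a solution
    reaching the boundary of \<open>B\<close> would have norm \<open>R + 1\<close> there, while the
    bound allows only \<open>R\<close>.\<close>
  define B where "B = cball (0::'a) (R + 1)"
  have B: "convex B" "closed B" "B \<noteq> {}"
    using z0 norm_ge_zero[of z0] by (auto simp: B_def simp del: norm_ge_zero)
  obtain L where L: "L-lipschitz_on B f" using lip by (auto simp: B_def)
  txt \<open>Composing with the nearest-point projection makes the field globally Lipschitz; by the a-priori
    bound the solution never leaves the ball where nothing has changed.\<close>
  define F where "F = (\<lambda>x. f (closest_point B x))"
  have FB: "F x = f x" if "x \<in> B" for x
    using that by (simp add: F_def closest_point_self)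
  have "1-lipschitz_on UNIV (closest_point B)"
    by (rule lipschitz_onI) (auto simp: closest_point_lipschitz[OF B])
  then have "(L * 1)-lipschitz_on UNIV F"
    unfolding F_def
    by (rule lipschitz_on_compose2) (use B L in \<open>auto intro!: lipschitz_on_subset[OF L] closest_point_in_set\<close>)
  from picard_iteration_global[OF this, of z0]
  obtain z where z0': "z 0 = z0"
    and zF: "\<And>t. 0 \<le> t \<Longrightarrow> (z has_vector_derivative F (z t)) (at t within {0..})" by auto
  have contz: "continuous_on {0..} z"
    unfolding continuous_on_eq_continuous_within
    using has_vector_derivative_continuous zF by force
  have zB: "norm (z t) < R + 1" if "0 \<le> t" for t
  proof (rule ccontr)
    assume "\<not> norm (z t) < R + 1"
    \<comment> \<open>The hitting times of the boundary sphere form a compact set. Up to the least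
      of them, \<open>T\<close>, the curve stays in \<open>B\<close>, where \<open>F\<close> equals
      \<open>f\<close>, so the a-priori bound applies at \<open>T\<close>.\<close>
    define A where "A = {s \<in> {0..t}. norm (z s) = R + 1}"
    have cont: "continuous_on {0..s} (\<lambda>s. norm (z s))" for s
      by (intro continuous_on_norm continuous_on_subset[OF contz]) auto
    have hit: "\<exists>r\<in>{0..s}. norm (z r) = R + 1" if "0 \<le> s" "R + 1 \<le> norm (z s)" for s
      using IVT'[of "\<lambda>s. norm (z s)" 0 "R + 1" s] cont that z0 z0' by auto
    have "closed A"
      unfolding A_def by (intro continuous_closed_preimage_constant cont) auto
    moreover have "bounded A" by (rule bounded_subset[of "{0..t}"]) (auto simp: A_def)
    ultimately have "compact A" by (simp add: compact_eq_bounded_closed)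
    moreover have "A \<noteq> {}"
      using hit[of t] that \<open>\<not> norm (z t) < R + 1\<close> by (auto simp: A_def)
    ultimately have "\<exists>T\<in>A. \<forall>s\<in>A. T \<le> s" by (rule compact_attains_inf)
    then obtain T where T: "T \<in> A" "\<And>s. s \<in> A \<Longrightarrow> T \<le> s" by auto
    have "z s \<in> B" if s: "s \<in> {0..T}" for s
    proof (rule ccontr)
      assume "z s \<notin> B"
      then have "R + 1 < norm (z s)" by (simp add: B_def)
      with hit[of s] s obtain r where r: "r \<in> {0..s}" "norm (z r) = R + 1" by force
      then have "r \<in> A" using s T(1) by (auto simp: A_def)
      then have "r = s" using T(2)[of r] r s by auto
      then show False using r \<open>R + 1 < norm (z s)\<close> by simp
    qed
    then have "(z has_vector_derivative f (z s)) (at s within {0..T})" if "s \<in> {0..T}" for s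
      using has_vector_derivative_within_subset[OF zF, of s "{0..T}"] FB that by force
    then have "norm (z T) \<le> R"
      using T(1) by (intro bound z0') (auto simp: A_def)
    then show False using T(1) by (simp add: A_def)
  qed
  have zf: "(z has_vector_derivative f (z t)) (at t within {0..})" if "0 \<le> t" for t
    using zF[OF that] FB[of "z t"] zB[OF that] by (simp add: B_def)
  show thesis
  proof (rule that[of z]; (intro allI impI ballI)?)
    fix T y t
    assume y0: "y 0 = z0" and t: "t \<in> {0..<T}"
      and y: "\<forall>t\<in>{0..<T}. (y has_vector_derivative f (y t)) (at t within {0..<T})"
    have y': "(y has_vector_derivative f (y r)) (at r within {0..s})"
      if "r \<in> {0..s}" "s \<le> t" for r s
      by (rule has_vector_derivative_within_subset[OF y[rule_format]]) (use that t in auto)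
    \<comment> \<open>Initial pieces of a competing solution are solutions too, so the a-priori
      bound keeps it in \<open>B\<close>; one Lipschitz constant then serves for both
      curves.\<close>
    have "norm (y s) \<le> R" if "s \<in> {0..t}" for s
    proof (rule bound)
      show "0 \<le> s" using that by simp
    qed (use that in \<open>auto intro: y0 y'\<close>)
    then have "y s \<in> B \<and> z s \<in> B" if "s \<in> {0..t}" for s
      using that zB[of s] by (force simp: B_def)
    moreover have "(z has_vector_derivative f (z s)) (at s within {0..t})" if "s \<in> {0..t}" for s
      using has_vector_derivative_within_subset[OF zf, of s "{0..t}"] that by force
    ultimately show "y t = z t"
      using t y0 z0' by (intro ode_solution_unique_Icc[OF L, of t y z] y') simp_all
  qed (use z0' in simp, rule zf)
qed

subsection \<open>Functions that are Lipschitz on every ball\<close>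

text \<open>Unlike global Lipschitz continuity, this property is stable under products, and it is
  the regularity that \<open>ode_global_solution_if_bounded\<close> asks of the field.\<close>

definition lipschitz_on_balls :: "('a::real_normed_vector \<Rightarrow> 'b::real_normed_vector) \<Rightarrow> bool" where
  "lipschitz_on_balls f \<longleftrightarrow> (\<forall>r. \<exists>L. L-lipschitz_on (cball 0 r) f)"

lemma lipschitz_on_ballsE:
  assumes "lipschitz_on_balls f"
  obtains L where "L \<ge> 0" "\<And>x y. norm x \<le> r \<Longrightarrow> norm y \<le> r \<Longrightarrow> norm (f x - f y) \<le> L * norm (x - y)"
proof -
  obtain L where "L-lipschitz_on (cball 0 r) f"
    using assms unfolding lipschitz_on_balls_def by blast
  then show thesis
    by (intro that[of L]) (auto dest: lipschitz_on_nonneg lipschitz_on_normD)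
qed

lemma lipschitz_on_ballsI:
  fixes f :: "'a::real_normed_vector \<Rightarrow> 'b::real_normed_vector"
  assumes "\<And>r. r \<ge> 0 \<Longrightarrow> \<exists>L. \<forall>x y. norm x \<le> r \<longrightarrow> norm y \<le> r \<longrightarrow> norm (f x - f y) \<le> L * norm (x - y)"
  shows "lipschitz_on_balls f"
  unfolding lipschitz_on_balls_def
proof
  fix r :: real
  obtain L where L: "\<And>x y. norm x \<le> max r 0 \<Longrightarrow> norm y \<le> max r 0 \<Longrightarrow> norm (f x - f y) \<le> L * norm (x - y)"
    using assms[of "max r 0"] by auto
  have "\<bar>L\<bar>-lipschitz_on (cball 0 r) f"
  proof (rule lipschitz_onI)
    fix x y :: 'a assume "x \<in> cball 0 r" "y \<in> cball 0 r"
    then have "norm (f x - f y) \<le> L * norm (x - y)" by (intro L) auto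
    also have "\<dots> \<le> \<bar>L\<bar> * norm (x - y)" by (intro mult_right_mono) auto
    finally show "dist (f x) (f y) \<le> \<bar>L\<bar> * dist x y" by (simp add: dist_norm)
  qed simp
  then show "\<exists>L. L-lipschitz_on (cball 0 r) f" ..
qed

lemma lipschitz_on_balls_bounded:
  assumes "lipschitz_on_balls f"
  obtains B where "B \<ge> 0" "\<And>x. norm x \<le> r \<Longrightarrow> norm (f x) \<le> B"
proof -
  obtain L where L: "L \<ge> 0" "\<And>x y. norm x \<le> \<bar>r\<bar> \<Longrightarrow> norm y \<le> \<bar>r\<bar> \<Longrightarrow> norm (f x - f y) \<le> L * norm (x - y)"
    by (rule lipschitz_on_ballsE[OF assms, where r = "\<bar>r\<bar>"]) blast
  show thesis
  proof (rule that)
    show "0 \<le> norm (f 0) + L * \<bar>r\<bar>" using L by simp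
    fix x :: 'a assume x: "norm x \<le> r"
    have "norm (f x - f 0) \<le> L * norm (x - 0)" using x by (intro L(2)) auto
    also have "\<dots> \<le> L * \<bar>r\<bar>" using x L by (intro mult_left_mono) auto
    finally show "norm (f x) \<le> norm (f 0) + L * \<bar>r\<bar>"
      using norm_triangle_ineq2[of "f x" "f 0"] by simp
  qed
qed

lemma lipschitz_on_balls_continuous:
  assumes "lipschitz_on_balls f"
  shows "continuous_on UNIV f"
proof -
  have "isCont f x" for x
  proof -
    obtain L where "L-lipschitz_on (cball 0 (norm x + 1)) f"
      using assms lipschitz_on_balls_def by blast
    then have "continuous_on (cball 0 (norm x + 1)) f" by (rule lipschitz_on_continuous_on)
    then show ?thesis by (rule continuous_on_interior) (rule interiorI[of "ball 0 (norm x + 1)"], auto)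
  qed
  then show ?thesis by (simp add: continuous_at_imp_continuous_on)
qed

lemma lipschitz_on_balls_const: "lipschitz_on_balls (\<lambda>x. c)"
  by (rule lipschitz_on_ballsI) (auto intro: exI[of _ 0])

lemma lipschitz_on_balls_bounded_linear: "bounded_linear f \<Longrightarrow> lipschitz_on_balls f"
  unfolding lipschitz_on_balls_def
  by (metis bounded_linear.lipschitz_boundE)

lemma lipschitz_on_balls_add:
  "lipschitz_on_balls f \<Longrightarrow> lipschitz_on_balls g \<Longrightarrow> lipschitz_on_balls (\<lambda>x. f x + g x)"
  unfolding lipschitz_on_balls_def using lipschitz_on_add by blast

lemma lipschitz_on_balls_diff:
  "lipschitz_on_balls f \<Longrightarrow> lipschitz_on_balls g \<Longrightarrow> lipschitz_on_balls (\<lambda>x. f x - g x)"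
  unfolding lipschitz_on_balls_def using lipschitz_on_diff by blast

text \<open>Being bounded on balls, \<open>g\<close> maps a ball into a ball, on which
  \<open>f\<close> has a Lipschitz constant.\<close>

lemma lipschitz_on_balls_compose:
  assumes "lipschitz_on_balls f" "lipschitz_on_balls g"
  shows "lipschitz_on_balls (\<lambda>x. f (g x))"
  unfolding lipschitz_on_balls_def
proof
  fix r
  obtain B where "\<And>x. norm x \<le> r \<Longrightarrow> norm (g x) \<le> B"
    by (rule lipschitz_on_balls_bounded[OF assms(2), where r = r]) blast
  then have B: "g ` cball 0 r \<subseteq> cball 0 B" by auto
  obtain L where "L-lipschitz_on (cball 0 B) f" using assms(1) lipschitz_on_balls_def by blast
  then have L: "L-lipschitz_on (g ` cball 0 r) f" using B by (rule lipschitz_on_subset)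
  obtain M where "M-lipschitz_on (cball 0 r) g" using assms(2) lipschitz_on_balls_def by blast
  with L show "\<exists>L. L-lipschitz_on (cball 0 r) (\<lambda>x. f (g x))"
    using lipschitz_on_compose2 by blast
qed

lemma lipschitz_on_balls_mult:
  fixes f g :: "'a::real_normed_vector \<Rightarrow> 'b::real_normed_algebra"
  assumes "lipschitz_on_balls f" "lipschitz_on_balls g"
  shows "lipschitz_on_balls (\<lambda>x. f x * g x)"
proof (rule lipschitz_on_ballsI)
  fix r :: real
  obtain L where L: "L \<ge> 0" "\<And>x y. norm x \<le> r \<Longrightarrow> norm y \<le> r \<Longrightarrow> norm (f x - f y) \<le> L * norm (x - y)"
    by (rule lipschitz_on_ballsE[OF assms(1), where r = r]) blast
  obtain M where M: "M \<ge> 0" "\<And>x y. norm x \<le> r \<Longrightarrow> norm y \<le> r \<Longrightarrow> norm (g x - g y) \<le> M * norm (x - y)"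
    by (rule lipschitz_on_ballsE[OF assms(2), where r = r]) blast
  obtain A where A: "A \<ge> 0" "\<And>x. norm x \<le> r \<Longrightarrow> norm (f x) \<le> A"
    by (rule lipschitz_on_balls_bounded[OF assms(1), where r = r]) blast
  obtain B where B: "B \<ge> 0" "\<And>x. norm x \<le> r \<Longrightarrow> norm (g x) \<le> B"
    by (rule lipschitz_on_balls_bounded[OF assms(2), where r = r]) blast
  have "norm (f x * g x - f y * g y) \<le> (L * B + A * M) * norm (x - y)"
    if "norm x \<le> r" "norm y \<le> r" for x y
  proof -
    have "f x * g x - f y * g y = (f x - f y) * g x + f y * (g x - g y)"
      by (simp add: algebra_simps)
    also have "norm \<dots> \<le> norm (f x - f y) * norm (g x) + norm (f y) * norm (g x - g y)"
      by (intro norm_triangle_le add_mono norm_mult_ineq)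
    also have "\<dots> \<le> (L * norm (x - y)) * B + A * (M * norm (x - y))"
      using that A B L M by (intro add_mono mult_mono) auto
    finally show ?thesis by (simp add: algebra_simps)
  qed
  then show "\<exists>L. \<forall>x y. norm x \<le> r \<longrightarrow> norm y \<le> r \<longrightarrow>
      norm (f x * g x - f y * g y) \<le> L * norm (x - y)" by blast
qed

lemma lipschitz_on_balls_sum:
  "(\<And>i. i \<in> I \<Longrightarrow> lipschitz_on_balls (f i)) \<Longrightarrow> lipschitz_on_balls (\<lambda>x. \<Sum>i\<in>I. f i x)"
  by (induction I rule: infinite_finite_induct)
    (auto intro: lipschitz_on_balls_const lipschitz_on_balls_add)

lemma lipschitz_on_balls_vec:
  fixes f :: "'a::real_normed_vector \<Rightarrow> real^'n"
  assumes "\<And>i. lipschitz_on_balls (\<lambda>x. f x $ i)"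
  shows "lipschitz_on_balls f"
proof (rule lipschitz_on_ballsI)
  fix r :: real
  have "\<exists>L. \<forall>x y. norm x \<le> r \<longrightarrow> norm y \<le> r \<longrightarrow> norm (f x $ i - f y $ i) \<le> L * norm (x - y)" for i
    by (rule lipschitz_on_ballsE[OF assms[of i], of r]) blast
  then obtain L where L: "\<And>i x y. norm x \<le> r \<Longrightarrow> norm y \<le> r \<Longrightarrow> norm (f x $ i - f y $ i) \<le> L i * norm (x - y)"
    by metis
  have "norm (f x - f y) \<le> (\<Sum>i\<in>UNIV. L i) * norm (x - y)" if "norm x \<le> r" "norm y \<le> r" for x y
  proof -
    have "norm (f x - f y) \<le> (\<Sum>i\<in>UNIV. \<bar>(f x - f y) $ i\<bar>)" by (rule norm_le_l1_cart)
    also have "\<dots> \<le> (\<Sum>i\<in>UNIV. L i * norm (x - y))"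
      using L[OF that] by (intro sum_mono) simp
    finally show ?thesis by (simp add: sum_distrib_right)
  qed
  then show "\<exists>L. \<forall>x y. norm x \<le> r \<longrightarrow> norm y \<le> r \<longrightarrow> norm (f x - f y) \<le> L * norm (x - y)" by blast
qed

lemmas lipschitz_on_balls_intros =
  lipschitz_on_balls_const lipschitz_on_balls_add lipschitz_on_balls_diff
  lipschitz_on_balls_mult lipschitz_on_balls_sum

text \<open>Comparison with \<open>(x, 0)\<close>, which lies in the same ball and where
  \<open>h\<close> vanishes. This bounds terms linear or quadratic in the velocity by a multiple of
  its norm.\<close>

lemma linear_growth_at_zero:
  assumes "lipschitz_on_balls h" and zero: "\<And>x. h (x, 0) = 0"
  obtains L where "L \<ge> 0" "\<And>x v. norm (x, v) \<le> r \<Longrightarrow> norm (h (x, v)) \<le> L * norm v"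
proof -
  obtain L where L: "L \<ge> 0" "\<And>y z. norm y \<le> r \<Longrightarrow> norm z \<le> r \<Longrightarrow> norm (h y - h z) \<le> L * norm (y - z)"
    by (rule lipschitz_on_ballsE[OF assms(1), where r = r]) blast
  have "norm (h (x, v)) \<le> L * norm v" if "norm (x, v) \<le> r" for x v
  proof -
    have "norm (x, 0::'b) \<le> norm (x, v)" by (simp add: norm_Pair)
    then have "norm (x, 0::'b) \<le> r" using that by (rule order_trans)
    from L(2)[OF that this] show ?thesis by (simp add: zero norm_Pair)
  qed
  with L(1) show thesis by (rule that)
qed

subsection \<open>Partial derivatives\<close>

lemma partial_deriv_eq_has_derivative:
  assumes "(f has_derivative f') (at x)"
  shows "partial_deriv i f x = f' (axis i 1)"
proof -
  have lin: "linear f'" using assms has_derivative_linear by blast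
  have "((\<lambda>t. f (x + t *\<^sub>R axis i 1)) has_derivative (\<lambda>t. f' (t *\<^sub>R axis i 1))) (at 0)"
    by (rule has_derivative_compose[where g=f, of "\<lambda>t. x + t *\<^sub>R axis i 1"])
      (use assms in \<open>auto intro!: derivative_eq_intros\<close>)
  then have "((\<lambda>t. f (x + t *\<^sub>R axis i 1)) has_field_derivative f' (axis i 1)) (at 0)"
    by (simp add: has_field_derivative_def linear_cmul[OF lin] mult_commute_abs)
  then show ?thesis unfolding partial_deriv_def by (rule DERIV_imp_deriv)
qed

lemma has_derivative_partial_deriv:
  assumes "f differentiable (at x)"
  shows "(f has_derivative (\<lambda>h. \<Sum>i\<in>UNIV. h $ i * partial_deriv i f x)) (at x)"
proof -
  obtain f' where f': "(f has_derivative f') (at x)" using assms differentiable_def by blast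
  have lin: "linear f'" using f' has_derivative_linear by blast
  have "f' = (\<lambda>h. \<Sum>i\<in>UNIV. h $ i * partial_deriv i f x)"
  proof
    fix h
    have "f' h = f' (\<Sum>i\<in>UNIV. h $ i *\<^sub>R axis i 1)"
      by (simp add: basis_expansion scalar_mult_eq_scaleR[symmetric])
    also have "\<dots> = (\<Sum>i\<in>UNIV. h $ i * partial_deriv i f x)"
      by (simp add: linear_sum[OF lin] linear_cmul[OF lin] partial_deriv_eq_has_derivative[OF f'])
    finally show "f' h = (\<Sum>i\<in>UNIV. h $ i * partial_deriv i f x)" .
  qed
  then show ?thesis using f' by simp
qed

lemma partial_deriv_mult:
  assumes "f differentiable (at x)" "g differentiable (at x)"
  shows "partial_deriv i (\<lambda>y. f y * g y) x = partial_deriv i f x * g x + f x * partial_deriv i g x"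
proof -
  obtain f' g' where f': "(f has_derivative f') (at x)" and g': "(g has_derivative g') (at x)"
    using assms differentiable_def by blast
  show ?thesis
    using partial_deriv_eq_has_derivative[OF has_derivative_mult[OF f' g']]
      partial_deriv_eq_has_derivative[OF f'] partial_deriv_eq_has_derivative[OF g'] by simp
qed

text \<open>On the compact ball the partial derivatives are bounded, hence so is the operator norm
  of the derivative; convexity of the ball lets the mean value inequality turn this into a Lipschitz
  constant.\<close>

lemma lipschitz_on_balls_if_continuous_partial_deriv:
  fixes f :: "real^'n::finite \<Rightarrow> real"
  assumes "\<And>x. f differentiable (at x)" "\<And>i. continuous_on UNIV (partial_deriv i f)"
  shows "lipschitz_on_balls f"
proof (rule lipschitz_on_ballsI)
  fix r :: real
  have "\<exists>B. \<forall>x\<in>cball 0 r. \<bar>partial_deriv i f x\<bar> \<le> B" for i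
  proof -
    have "bounded (partial_deriv i f ` cball 0 r)"
      by (intro compact_imp_bounded compact_continuous_image continuous_on_subset[OF assms(2)]) auto
    then show ?thesis by (auto simp: bounded_iff)
  qed
  then obtain B where B: "\<And>i x. norm x \<le> r \<Longrightarrow> \<bar>partial_deriv i f x\<bar> \<le> B i"
    by (metis mem_cball_0)
  have "norm (f x - f y) \<le> (\<Sum>i\<in>UNIV. B i) * norm (x - y)" if "norm x \<le> r" "norm y \<le> r" for x y
  proof (rule differentiable_bound)
    show "(f has_derivative (\<lambda>h. \<Sum>i\<in>UNIV. h $ i * partial_deriv i f z)) (at z within cball 0 r)" for z
      using has_derivative_partial_deriv[OF assms(1)] has_derivative_at_withinI by blast
    show "onorm (\<lambda>h. \<Sum>i\<in>UNIV. h $ i * partial_deriv i f z) \<le> (\<Sum>i\<in>UNIV. B i)"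
      if "z \<in> cball 0 r" for z
    proof (rule onorm_le)
      fix h :: "real^'n"
      have "norm (\<Sum>i\<in>UNIV. h $ i * partial_deriv i f z) \<le> (\<Sum>i\<in>UNIV. norm h * B i)"
      proof (rule sum_norm_le)
        fix i
        show "norm (h $ i * partial_deriv i f z) \<le> norm h * B i"
          unfolding norm_mult
          by (intro mult_mono) (use B[of z i] that component_le_norm_cart[of h i] in auto)
      qed
      then show "norm (\<Sum>i\<in>UNIV. h $ i * partial_deriv i f z) \<le> (\<Sum>i\<in>UNIV. B i) * norm h"
        by (simp add: sum_distrib_left mult.commute)
    qed
  qed (use that in auto)
  then show "\<exists>L. \<forall>x y. norm x \<le> r \<longrightarrow> norm y \<le> r \<longrightarrow> norm (f x - f y) \<le> L * norm (x - y)" by blast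
qed

subsection \<open>Coercivity and Lyapunov constants\<close>

lemma has_vector_derivative_vec:
  fixes f :: "real \<Rightarrow> real^'n"
  assumes "\<And>i. ((\<lambda>t. f t $ i) has_vector_derivative f' $ i) (at t within S)"
  shows "(f has_vector_derivative f') (at t within S)"
  unfolding has_vector_derivative_def
  by (subst has_derivative_componentwise_within)
    (use assms in \<open>auto simp: Basis_vec_def inner_axis has_vector_derivative_def\<close>)

lemma has_vector_derivative_vec_nth:
  fixes f :: "real \<Rightarrow> real^'n"
  assumes "(f has_vector_derivative f') F"
  shows "((\<lambda>t. f t $ i) has_vector_derivative f' $ i) F"
  by (rule bounded_linear.has_vector_derivative[OF bounded_linear_vec_nth assms])

text \<open>The quadratic form attains a positive minimum on the compact unit sphere, and
  homogeneity of degree 2 carries it to all vectors.\<close>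

lemma sym_pos_def_coercive:
  fixes A :: "real^'n^'n"
  assumes "sym_pos_def A"
  obtains c where "c > 0" "\<And>x. c * (norm x)\<^sup>2 \<le> x \<bullet> (A *v x)"
proof -
  have "compact (sphere (0::real^'n) 1)" by simp
  moreover have "axis i 1 \<in> sphere (0::real^'n) 1" for i by simp
  then have "sphere (0::real^'n) 1 \<noteq> {}" by blast
  moreover have "continuous_on (sphere (0::real^'n) 1) (\<lambda>x. x \<bullet> (A *v x))"
    by (intro continuous_intros)
  ultimately obtain u where u: "u \<in> sphere 0 1" "\<And>x. x \<in> sphere 0 1 \<Longrightarrow> u \<bullet> (A *v u) \<le> x \<bullet> (A *v x)"
    using continuous_attains_inf by (metis (no_types, lifting))
  show thesis
  proof
    have "u \<noteq> 0" using u by auto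
    then show "u \<bullet> (A *v u) > 0" using assms by (simp add: sym_pos_def_def)
    fix x :: "real^'n"
    show "u \<bullet> (A *v u) * (norm x)\<^sup>2 \<le> x \<bullet> (A *v x)"
    proof (cases "x = 0")
      case False
      define y where "y = (1 / norm x) *\<^sub>R x"
      have "x = norm x *\<^sub>R y" using False by (simp add: y_def)
      then have "x \<bullet> (A *v x) = (norm x)\<^sup>2 * (y \<bullet> (A *v y))"
        by (metis inner_scaleR_left inner_scaleR_right matrix_vector_mult_scaleR mult.assoc power2_eq_square)
      moreover have "y \<in> sphere 0 1" using False by (simp add: y_def)
      ultimately show ?thesis using u(2)[of y] by (simp add: mult.commute mult_right_mono)
    qed simp
  qed
qed

lemma sym_matrix_inner:
  fixes A :: "real^'n^'n"
  assumes "transpose A = A"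
  shows "x \<bullet> (A *v y) = (A *v x) \<bullet> y"
  by (metis assms dot_lmul_matrix vector_transpose_matrix)

text \<open>The scalar core of the Lyapunov argument, to be read with \<open>a\<close> and
  \<open>b\<close> the norms of \<open>v\<close> and \<open>e\<close>, \<open>s\<close> the cross
  term, and \<open>eh\<close> the remaining part of its derivative. The constants are chosen before
  these quantities and hence serve for all times.\<close>

lemma strict_lyapunov_constants:
  fixes \<delta> \<kappa> L M N :: real
  assumes "\<delta> > 0" "\<kappa> > 0" "L \<ge> 0" "M \<ge> 0" "N \<ge> 0"
  obtains \<epsilon> l m where "l > 0" "m > 0"
    and "\<And>a b vGv eKe vDv s eh. a \<ge> 0 \<Longrightarrow> b \<ge> 0 \<Longrightarrow> a\<^sup>2 \<le> vGv \<Longrightarrow> vGv \<le> M * a\<^sup>2 \<Longrightarrow> \<kappa> * b\<^sup>2 \<le> eKe \<Longrightarrow>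
      eKe \<le> N * b\<^sup>2 \<Longrightarrow> \<delta> * a\<^sup>2 \<le> vDv \<Longrightarrow> \<bar>s\<bar> \<le> M * (a * b) \<Longrightarrow> eh \<le> L * (a * b) \<Longrightarrow>
      m * b\<^sup>2 \<le> 1/2 * vGv + 1/2 * eKe + \<epsilon> * s \<and>
      - vDv + \<epsilon> * (vGv - eKe + eh) \<le> - l * (1/2 * vGv + 1/2 * eKe + \<epsilon> * s)"
proof -
  define m0 where "m0 = min 1 \<kappa>"
  \<comment> \<open>After Young's inequality, \<open>J * a\<^sup>2\<close> bounds the positive part
    of what the cross term adds to the derivative; the summand 1 keeps \<open>J\<close>
    positive.\<close>
  define J where "J = M + 1 + L\<^sup>2 / (2 * \<kappa>)"
  \<comment> \<open>The first bound lets half of the damping absorb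
    \<open>\<epsilon> * J * a\<^sup>2\<close>; the second keeps the cross term below half of the
    lower bound for the energy.\<close>
  define \<epsilon> where "\<epsilon> = min (\<delta> / (2 * J)) (m0 / (2 * (M + 1)))"
  \<comment> \<open>\<open>\<mu>\<close> is the dissipation left for both squares, and
    \<open>Q\<close> times \<open>a\<^sup>2 + b\<^sup>2\<close> bounds the Lyapunov function from
    above; the decay rate is therefore \<open>\<mu> / Q\<close>.\<close>
  define \<mu> where "\<mu> = min (\<delta> / 2) (\<epsilon> * \<kappa> / 2)"
  define Q where "Q = M + N + m0"
  have J: "J > 0" using assms by (simp add: J_def add_pos_nonneg)
  have m0: "m0 > 0" "m0 \<le> 1" "m0 \<le> \<kappa>" using assms by (auto simp: m0_def)
  have eps: "\<epsilon> > 0" using J m0 assms by (simp add: \<epsilon>_def)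
  have "\<epsilon> \<le> \<delta> / (2 * J)" "\<epsilon> \<le> m0 / (2 * (M + 1))" by (simp_all add: \<epsilon>_def)
  then have eps_J: "\<epsilon> * J \<le> \<delta> / 2" and "\<epsilon> * (M + 1) \<le> m0 / 2"
    using J assms by (simp_all add: pos_le_divide_eq mult_ac)
  then have eps_M: "\<epsilon> * M \<le> m0 / 2" using eps by (simp add: algebra_simps)
  have mu: "\<mu> > 0" "\<mu> \<le> \<delta> / 2" "\<mu> \<le> \<epsilon> * \<kappa> / 2" using eps assms by (auto simp: \<mu>_def)
  have Q: "Q > 0" using m0 assms by (simp add: Q_def)
  show thesis
  proof (rule that[of "\<mu> / Q" "m0 / 4" \<epsilon>])
    fix a b vGv eKe vDv s eh :: real
    assume ab: "a \<ge> 0" "b \<ge> 0" and G: "a\<^sup>2 \<le> vGv" "vGv \<le> M * a\<^sup>2" and K: "\<kappa> * b\<^sup>2 \<le> eKe" "eKe \<le> N * b\<^sup>2"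
      and D: "\<delta> * a\<^sup>2 \<le> vDv" and s: "\<bar>s\<bar> \<le> M * (a * b)" and eh: "eh \<le> L * (a * b)"
    have p: "0 \<le> m0 * a\<^sup>2" "0 \<le> m0 * b\<^sup>2" "0 \<le> M * a\<^sup>2" "0 \<le> M * b\<^sup>2" "0 \<le> N * a\<^sup>2" "0 \<le> N * b\<^sup>2"
      using m0 assms by simp_all
    have ab2: "a * b \<le> (a\<^sup>2 + b\<^sup>2) / 2"
      using sum_squares_bound[of a b] by simp
    have "\<bar>\<epsilon> * s\<bar> \<le> \<epsilon> * M * (a * b)"
      using s eps by (simp add: abs_mult)
    also have "\<dots> \<le> m0 / 2 * (a * b)" using eps_M ab by (intro mult_right_mono) auto
    also have "\<dots> \<le> m0 / 2 * ((a\<^sup>2 + b\<^sup>2) / 2)" using ab2 m0 by (intro mult_left_mono) auto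
    finally have es: "\<bar>\<epsilon> * s\<bar> \<le> m0 / 4 * (a\<^sup>2 + b\<^sup>2)" by simp
    have mG: "m0 * a\<^sup>2 \<le> vGv" using G mult_right_mono[OF m0(2), of "a\<^sup>2"] by simp
    have mK: "m0 * b\<^sup>2 \<le> eKe" using K mult_right_mono[OF m0(3), of "b\<^sup>2"] by simp
    have low: "m0 / 4 * b\<^sup>2 \<le> 1/2 * vGv + 1/2 * eKe + \<epsilon> * s"
      using es mG mK p by (simp add: algebra_simps abs_le_iff)
    have "1/2 * vGv + 1/2 * eKe + \<epsilon> * s \<le> M * a\<^sup>2 + N * b\<^sup>2 + m0 * (a\<^sup>2 + b\<^sup>2)"
      using es G K p by (simp add: algebra_simps abs_le_iff)
    also have "\<dots> \<le> Q * (a\<^sup>2 + b\<^sup>2)"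
      using p by (simp add: Q_def algebra_simps)
    finally have up: "1/2 * vGv + 1/2 * eKe + \<epsilon> * s \<le> Q * (a\<^sup>2 + b\<^sup>2)" .
    have "L * (a * b) \<le> \<kappa> / 2 * b\<^sup>2 + L\<^sup>2 / (2 * \<kappa>) * a\<^sup>2"
    proof -
      \<comment> \<open>Young's inequality, read off from a square weighted so that it costs only
        half of \<open>\<kappa> * b\<^sup>2\<close>.\<close>
      have "0 \<le> (\<kappa> * b - L * a)\<^sup>2 / (2 * \<kappa>)" using assms by simp
      also have "\<dots> = \<kappa> / 2 * b\<^sup>2 + L\<^sup>2 / (2 * \<kappa>) * a\<^sup>2 - L * (a * b)"
        using assms by (simp add: field_simps power2_eq_square)
      finally show ?thesis by simp
    qed
    moreover have "J * a\<^sup>2 = M * a\<^sup>2 + a\<^sup>2 + L\<^sup>2 / (2 * \<kappa>) * a\<^sup>2"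
      by (simp add: J_def algebra_simps)
    ultimately have "vGv - eKe + eh \<le> J * a\<^sup>2 - \<kappa> / 2 * b\<^sup>2"
      using eh G K zero_le_power2[of a] by linarith
    then have "\<epsilon> * (vGv - eKe + eh) \<le> \<epsilon> * (J * a\<^sup>2 - \<kappa> / 2 * b\<^sup>2)"
      using eps by (intro mult_left_mono) auto
    also have "\<dots> = (\<epsilon> * J) * a\<^sup>2 - (\<epsilon> * \<kappa> / 2) * b\<^sup>2" by (simp add: algebra_simps)
    also have "\<dots> \<le> \<delta> / 2 * a\<^sup>2 - \<mu> * b\<^sup>2"
      using eps_J mu by (intro diff_mono mult_right_mono) auto
    finally have "- vDv + \<epsilon> * (vGv - eKe + eh) \<le> - (\<delta> / 2 * a\<^sup>2) - \<mu> * b\<^sup>2"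
      using D by (simp add: algebra_simps)
    also have "\<dots> \<le> - (\<mu> * (a\<^sup>2 + b\<^sup>2))"
      using mult_right_mono[OF mu(2), of "a\<^sup>2"] by (simp add: algebra_simps)
    also have "\<dots> = - (\<mu> / Q) * (Q * (a\<^sup>2 + b\<^sup>2))" using Q by simp
    also have "\<dots> \<le> - (\<mu> / Q) * (1/2 * vGv + 1/2 * eKe + \<epsilon> * s)"
      using up mu Q by (intro mult_left_mono_neg) auto
    finally show "m0 / 4 * b\<^sup>2 \<le> 1/2 * vGv + 1/2 * eKe + \<epsilon> * s \<and>
      - vDv + \<epsilon> * (vGv - eKe + eh) \<le> - (\<mu> / Q) * (1/2 * vGv + 1/2 * eKe + \<epsilon> * s)"
      using low by simp
  qed (use mu Q m0 in auto)
qed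

subsection \<open>Damped geodesic motion in a potential well\<close>

text \<open>The energy argument works for any metric that dominates the Euclidean one; first
  derivatives that are Lipschitz on balls make the Christoffel terms so too, which gives existence
  and uniqueness.\<close>

locale damped_geodesic_system =
  fixes g :: "real^'n::finite \<Rightarrow> real^'n^'n" and K D :: "real^'n^'n" and xstar :: "real^'n"
  assumes metric_sym: "\<And>x. transpose (g x) = g x"
    and metric_ge: "\<And>x v. v \<bullet> v \<le> v \<bullet> (g x *v v)"
    and metric_diff: "\<And>i j x. (\<lambda>y. g y $ i $ j) differentiable (at x)"
    and metric_partial: "\<And>k i j. lipschitz_on_balls (partial_deriv k (\<lambda>y. g y $ i $ j))"
    and K: "sym_pos_def K" and D: "sym_pos_def D"
begin

definition force :: "real^'n \<Rightarrow> real^'n \<Rightarrow> real^'n" where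
  "force x v = K *v (x - xstar) + D *v v"

definition acceleration :: "real^'n \<Rightarrow> real^'n \<Rightarrow> real^'n" where
  "acceleration x v = - (matrix_inv (g x) *v force x v) - christoffel_matrix g x v *v v"

text \<open>Christoffel symbols of the first kind (lower index \<open>m\<close>), contracted twice with \<open>v\<close>.\<close>

definition inertia :: "real^'n \<Rightarrow> real^'n \<Rightarrow> real^'n" where
  "inertia x v = (\<chi> m. 1/2 * (\<Sum>j\<in>UNIV. \<Sum>i\<in>UNIV.
     (partial_deriv i (\<lambda>y. g y $ m $ j) x + partial_deriv j (\<lambda>y. g y $ m $ i) x
      - partial_deriv m (\<lambda>y. g y $ i $ j) x) * v $ i * v $ j))"

definition metric_deriv :: "real^'n \<Rightarrow> real^'n \<Rightarrow> real^'n^'n" where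
  "metric_deriv x v = (\<chi> i j. \<Sum>k\<in>UNIV. v $ k * partial_deriv k (\<lambda>y. g y $ i $ j) x)"

section \<open>Algebra of the metric and the Christoffel symbols\<close>

lemma metric_nth_sym: "g x $ i $ j = g x $ j $ i"
  by (metis metric_sym transpose_def vec_lambda_beta)

lemma metric_inner: "x \<bullet> (g z *v y) = (g z *v x) \<bullet> y"
  by (rule sym_matrix_inner[OF metric_sym])

lemma norm_le_metric: "norm v \<le> norm (g x *v v)"
proof (cases "v = 0")
  case False
  have "norm v * norm v \<le> norm v * norm (g x *v v)"
    using metric_ge[of v x] norm_cauchy_schwarz[of v "g x *v v"]
    by (simp add: dot_square_norm power2_eq_square)
  then show ?thesis using False by simp
qed simp

text \<open>By \<open>norm_le_metric\<close> the kernel is trivial, so the matrix is invertible and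
  the choice behind \<open>matrix_inv\<close> does yield an inverse.\<close>

lemma metric_inv: "g x *v (matrix_inv (g x) *v u) = u"
proof -
  have "\<forall>v. g x *v v = 0 \<longrightarrow> v = 0"
    using norm_le_metric[of _ x] by (metis norm_le_zero_iff norm_zero)
  then have "invertible (g x)"
    using invertible_left_inverse matrix_left_invertible_ker by blast
  then have "g x ** matrix_inv (g x) = mat 1"
    unfolding invertible_def matrix_inv_def by (rule someI_ex[THEN conjunct1])
  then show ?thesis
    by (simp add: matrix_vector_mul_assoc)
qed

text \<open>Contracting twice with \<open>v\<close> commutes with raising the index, so the inverse
  metric factors out as one matrix product, which multiplication by the metric undoes.\<close>

lemma christoffel_matrix_mult: "christoffel_matrix g x v *v v = matrix_inv (g x) *v inertia x v"
proof (simp only: vec_eq_iff, intro allI)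
  fix q
  define A where "A = (\<lambda>i j m. partial_deriv i (\<lambda>y. g y $ m $ j) x
    + partial_deriv j (\<lambda>y. g y $ m $ i) x - partial_deriv m (\<lambda>y. g y $ i $ j) x)"
  define M where "M = matrix_inv (g x)"
  have "(christoffel_matrix g x v *v v) $ q
      = (\<Sum>j\<in>UNIV. (\<Sum>i\<in>UNIV. (1/2 * (\<Sum>m\<in>UNIV. M $ q $ m * A i j m)) * v $ i) * v $ j)"
    by (simp add: christoffel_matrix_def christoffel_def matrix_vector_mult_def A_def M_def)
  also have "\<dots> = (\<Sum>j\<in>UNIV. \<Sum>i\<in>UNIV. \<Sum>m\<in>UNIV. M $ q $ m * (1/2 * (A i j m * v $ i * v $ j)))"
    by (simp add: sum_distrib_left sum_distrib_right mult_ac)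
  also have "\<dots> = (\<Sum>j\<in>UNIV. \<Sum>m\<in>UNIV. \<Sum>i\<in>UNIV. M $ q $ m * (1/2 * (A i j m * v $ i * v $ j)))"
    by (rule sum.cong[OF refl], rule sum.swap)
  also have "\<dots> = (\<Sum>m\<in>UNIV. \<Sum>j\<in>UNIV. \<Sum>i\<in>UNIV. M $ q $ m * (1/2 * (A i j m * v $ i * v $ j)))"
    by (rule sum.swap)
  also have "\<dots> = (\<Sum>m\<in>UNIV. M $ q $ m * (1/2 * (\<Sum>j\<in>UNIV. \<Sum>i\<in>UNIV. A i j m * v $ i * v $ j)))"
    by (simp add: sum_distrib_left)
  also have "\<dots> = (M *v inertia x v) $ q"
    by (simp add: inertia_def matrix_vector_mult_def A_def)
  finally show "(christoffel_matrix g x v *v v) $ q = (matrix_inv (g x) *v inertia x v) $ q"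
    by (simp add: M_def)
qed

lemma metric_mult_acceleration: "g x *v acceleration x v = - (force x v + inertia x v)"
proof -
  have "acceleration x v = matrix_inv (g x) *v (- (force x v + inertia x v))"
    by (simp add: acceleration_def christoffel_matrix_mult matrix_vector_right_distrib matrix_vector_mult_diff_distrib
        linear_neg[OF matrix_vector_mul_linear])
  then show ?thesis by (simp only: metric_inv)
qed

text \<open>Contracted with the velocity, the last two terms of the Christoffel symbol cancel.\<close>

lemma inner_inertia: "v \<bullet> inertia x v = 1/2 * (v \<bullet> (metric_deriv x v *v v))"
proof -
  define B where "B = (\<lambda>k i j. partial_deriv k (\<lambda>y. g y $ i $ j) x)"
  have Bsym: "B k i j = B k j i" for k i j
    unfolding B_def using metric_nth_sym by presburger
  define T where "T = (\<lambda>m j i. v $ m * (v $ i * v $ j))"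
  define S where "S = (\<Sum>m\<in>UNIV. \<Sum>j\<in>UNIV. \<Sum>i\<in>UNIV. B i m j * T m j i)"
  have "v \<bullet> inertia x v = (\<Sum>m\<in>UNIV. v $ m * (1/2 * (\<Sum>j\<in>UNIV. \<Sum>i\<in>UNIV.
      (B i m j + B j m i - B m i j) * v $ i * v $ j)))"
    by (simp add: inner_vec_def inertia_def B_def)
  also have "\<dots> = 1/2 * (\<Sum>m\<in>UNIV. \<Sum>j\<in>UNIV. \<Sum>i\<in>UNIV.
      B i m j * T m j i + B j m i * T m j i - B m i j * T m j i)"
    by (simp add: sum_distrib_left T_def algebra_simps)
  also have "\<dots> = 1/2 * (S + (\<Sum>m\<in>UNIV. \<Sum>j\<in>UNIV. \<Sum>i\<in>UNIV. B j m i * T m j i)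
      - (\<Sum>m\<in>UNIV. \<Sum>j\<in>UNIV. \<Sum>i\<in>UNIV. B m i j * T m j i))"
    by (simp add: S_def sum.distrib sum_subtractf)
  \<comment> \<open>Exchanging the names \<open>m\<close> and \<open>j\<close> matches the two sums:
    the monomial \<open>T\<close> is symmetric, and so is the metric.\<close>
  also have "(\<Sum>m\<in>UNIV. \<Sum>j\<in>UNIV. \<Sum>i\<in>UNIV. B j m i * T m j i)
      = (\<Sum>m\<in>UNIV. \<Sum>j\<in>UNIV. \<Sum>i\<in>UNIV. B m i j * T m j i)"
    by (subst sum.swap) (simp add: T_def Bsym[of _ _ "_"] mult_ac)
  also have "1/2 * (S + (\<Sum>m\<in>UNIV. \<Sum>j\<in>UNIV. \<Sum>i\<in>UNIV. B m i j * T m j i)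
      - (\<Sum>m\<in>UNIV. \<Sum>j\<in>UNIV. \<Sum>i\<in>UNIV. B m i j * T m j i)) = 1/2 * S" by simp
  also have "S = v \<bullet> (metric_deriv x v *v v)"
    by (simp add: S_def T_def inner_vec_def metric_deriv_def matrix_vector_mult_def B_def
        sum_distrib_left sum_distrib_right mult_ac)
  finally show ?thesis .
qed

section \<open>Derivatives of the metric, the energy and the cross term along a motion\<close>

lemma metric_has_vector_derivative:
  assumes "(x has_vector_derivative v) (at t within S)"
  shows "((\<lambda>t. g (x t) $ i $ j) has_vector_derivative metric_deriv (x t) v $ i $ j) (at t within S)"
proof -
  have "((\<lambda>t. g (x t) $ i $ j) has_derivative
      (\<lambda>h. \<Sum>k\<in>UNIV. (h *\<^sub>R v) $ k * partial_deriv k (\<lambda>y. g y $ i $ j) (x t))) (at t within S)"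
    using assms has_derivative_partial_deriv[OF metric_diff, of i j "x t"]
    unfolding has_vector_derivative_def by (rule has_derivative_compose)
  then show ?thesis
    by (simp add: has_vector_derivative_def metric_deriv_def sum_distrib_left mult_ac)
qed

lemma metric_mult_has_vector_derivative:
  assumes x: "(x has_vector_derivative v) (at t within S)"
    and u: "(u has_vector_derivative u') (at t within S)"
  shows "((\<lambda>t. g (x t) *v u t) has_vector_derivative (metric_deriv (x t) v *v u t + g (x t) *v u'))
    (at t within S)"
proof (rule has_vector_derivative_vec)
  fix i
  have "((\<lambda>t. \<Sum>j\<in>UNIV. g (x t) $ i $ j * u t $ j) has_vector_derivative
      (\<Sum>j\<in>UNIV. g (x t) $ i $ j * u' $ j + metric_deriv (x t) v $ i $ j * u t $ j)) (at t within S)"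
    by (intro has_vector_derivative_sum has_vector_derivative_mult
        metric_has_vector_derivative[OF x] has_vector_derivative_vec_nth[OF u])
  then show "((\<lambda>t. (g (x t) *v u t) $ i) has_vector_derivative
      (metric_deriv (x t) v *v u t + g (x t) *v u') $ i) (at t within S)"
    by (simp add: matrix_vector_mult_def sum.distrib add.commute)
qed

definition energy :: "real^'n \<Rightarrow> real^'n \<Rightarrow> real" where
  "energy x v = 1/2 * (v \<bullet> (g x *v v)) + 1/2 * ((x - xstar) \<bullet> (K *v (x - xstar)))"

text \<open>The change of the metric contributes \<open>1/2 v . G' v\<close>, which the inertia
  takes back by \<open>inner_inertia\<close>; the elastic force cancels the derivative of the
  potential, and only the damping remains.\<close>

lemma energy_has_vector_derivative:
  assumes x: "(x has_vector_derivative v t) (at t within S)"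
    and v: "(v has_vector_derivative acceleration (x t) (v t)) (at t within S)"
  shows "((\<lambda>t. energy (x t) (v t)) has_vector_derivative - (v t \<bullet> (D *v v t))) (at t within S)"
proof -
  have e: "((\<lambda>t. x t - xstar) has_vector_derivative v t) (at t within S)"
    using has_vector_derivative_diff[OF x has_vector_derivative_const] by simp
  have Ke: "((\<lambda>t. K *v (x t - xstar)) has_vector_derivative K *v v t) (at t within S)"
    by (rule bounded_linear.has_vector_derivative[OF matrix_vector_mul_bounded_linear e])
  have Kin: "a \<bullet> (K *v b) = (K *v a) \<bullet> b" for a b
    using K by (intro sym_matrix_inner) (simp add: sym_pos_def_def)
  show ?thesis
    unfolding energy_def
  proof (rule has_vector_derivative_eq_rhs)
    show "((\<lambda>t. 1/2 * (v t \<bullet> (g (x t) *v v t)) + 1/2 * ((x t - xstar) \<bullet> (K *v (x t - xstar))))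
      has_vector_derivative
        1/2 * (v t \<bullet> (metric_deriv (x t) (v t) *v v t + g (x t) *v acceleration (x t) (v t))
          + acceleration (x t) (v t) \<bullet> (g (x t) *v v t))
        + 1/2 * ((x t - xstar) \<bullet> (K *v v t) + v t \<bullet> (K *v (x t - xstar)))) (at t within S)"
      by (intro has_vector_derivative_add has_vector_derivative_mult_right
          bounded_bilinear.has_vector_derivative[OF bounded_bilinear_inner]
          metric_mult_has_vector_derivative x v e Ke)
    show "1/2 * (v t \<bullet> (metric_deriv (x t) (v t) *v v t + g (x t) *v acceleration (x t) (v t))
          + acceleration (x t) (v t) \<bullet> (g (x t) *v v t))
        + 1/2 * ((x t - xstar) \<bullet> (K *v v t) + v t \<bullet> (K *v (x t - xstar))) = - (v t \<bullet> (D *v v t))"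
      using Kin[of "x t - xstar" "v t"] inner_inertia[of "v t" "x t"]
        metric_inner[of "acceleration (x t) (v t)" "x t" "v t"]
      by (simp add: inner_add_right inner_diff_right metric_mult_acceleration force_def inner_commute algebra_simps)
  qed
qed

text \<open>The energy alone does not dissipate at points with zero velocity. The derivative of this
  term contains \<open>- e . K e\<close>, which supplies the missing decay in the position.\<close>

definition cross_term :: "real^'n \<Rightarrow> real^'n \<Rightarrow> real" where
  "cross_term x v = (x - xstar) \<bullet> (g x *v v)"

lemma cross_term_has_vector_derivative:
  assumes x: "(x has_vector_derivative v t) (at t within S)"
    and v: "(v has_vector_derivative acceleration (x t) (v t)) (at t within S)"
  shows "((\<lambda>t. cross_term (x t) (v t)) has_vector_derivative
    (v t \<bullet> (g (x t) *v v t) - (x t - xstar) \<bullet> (K *v (x t - xstar))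
     + (x t - xstar) \<bullet> (metric_deriv (x t) (v t) *v v t - inertia (x t) (v t) - D *v v t)))
    (at t within S)"
proof -
  have e: "((\<lambda>t. x t - xstar) has_vector_derivative v t) (at t within S)"
    using has_vector_derivative_diff[OF x has_vector_derivative_const] by simp
  show ?thesis
    unfolding cross_term_def
    by (rule has_vector_derivative_eq_rhs[OF bounded_bilinear.has_vector_derivative
          [OF bounded_bilinear_inner e metric_mult_has_vector_derivative[OF x v]]])
      (simp add: inner_add_right inner_diff_right metric_mult_acceleration force_def algebra_simps)
qed

section \<open>The first-order system and its Lipschitz property\<close>

definition phase_field :: "(real^'n) \<times> (real^'n) \<Rightarrow> (real^'n) \<times> (real^'n)" where
  "phase_field z = (snd z, acceleration (fst z) (snd z))"

lemma lipschitz_fst: "lipschitz_on_balls f \<Longrightarrow> lipschitz_on_balls (\<lambda>z. f (fst z))"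
  by (rule lipschitz_on_balls_compose) (auto intro: lipschitz_on_balls_bounded_linear bounded_linear_fst)

lemma lipschitz_snd_nth: "lipschitz_on_balls (\<lambda>z. snd z $ i)"
  by (intro lipschitz_on_balls_bounded_linear bounded_linear_compose[OF bounded_linear_vec_nth bounded_linear_snd])

lemma lipschitz_metric: "lipschitz_on_balls (\<lambda>x. g x $ i $ j)"
  by (rule lipschitz_on_balls_if_continuous_partial_deriv
      [OF metric_diff lipschitz_on_balls_continuous[OF metric_partial]])

lemma lipschitz_metric_mult: "lipschitz_on_balls (\<lambda>z. g (fst z) *v snd z)"
  by (rule lipschitz_on_balls_vec)
    (simp add: matrix_vector_mult_def,
      intro lipschitz_on_balls_intros lipschitz_snd_nth lipschitz_fst lipschitz_metric)

lemma lipschitz_inertia: "lipschitz_on_balls (\<lambda>z. inertia (fst z) (snd z))"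
  by (rule lipschitz_on_balls_vec)
    (simp only: inertia_def vec_lambda_beta,
      intro lipschitz_on_balls_intros lipschitz_snd_nth
        lipschitz_fst[OF metric_partial])

lemma lipschitz_metric_deriv: "lipschitz_on_balls (\<lambda>z. metric_deriv (fst z) (snd z) *v snd z)"
  by (rule lipschitz_on_balls_vec)
    (simp only: metric_deriv_def matrix_vector_mult_def vec_lambda_beta,
      intro lipschitz_on_balls_intros lipschitz_snd_nth
        lipschitz_fst[OF metric_partial])

lemma lipschitz_mult_snd: "lipschitz_on_balls (\<lambda>z. (A::real^'n^'n) *v snd z)"
  by (intro lipschitz_on_balls_bounded_linear
      bounded_linear_compose[OF matrix_vector_mul_bounded_linear bounded_linear_snd])

lemma lipschitz_force: "lipschitz_on_balls (\<lambda>z. force (fst z) (snd z))"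
  unfolding force_def matrix_vector_mult_diff_distrib
  by (intro lipschitz_on_balls_intros lipschitz_mult_snd lipschitz_on_balls_bounded_linear
      bounded_linear_compose[OF matrix_vector_mul_bounded_linear bounded_linear_fst])

text \<open>The lower bound on the metric turns differences of \<open>G a\<close> into differences of \<open>a\<close>, so the
  regularity of the inverse matrix is never needed.\<close>

lemma lipschitz_acceleration: "lipschitz_on_balls (\<lambda>z. acceleration (fst z) (snd z))"
proof (rule lipschitz_on_ballsI)
  fix r :: real
  define b where "b = (\<lambda>z. force (fst z) (snd z) + inertia (fst z) (snd z))"
  have b: "lipschitz_on_balls b"
    unfolding b_def by (intro lipschitz_on_balls_add lipschitz_force lipschitz_inertia)
  have ga: "g (fst z) *v acceleration (fst z) (snd z) = - b z" for z
    by (simp add: metric_mult_acceleration b_def)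
  obtain L where L: "L \<ge> 0" "\<And>x y. norm x \<le> r \<Longrightarrow> norm y \<le> r \<Longrightarrow> norm (b x - b y) \<le> L * norm (x - y)"
    by (rule lipschitz_on_ballsE[OF b, where r = r]) blast
  obtain B where B: "B \<ge> 0" "\<And>x. norm x \<le> r \<Longrightarrow> norm (b x) \<le> B"
    by (rule lipschitz_on_balls_bounded[OF b, where r = r]) blast
  \<comment> \<open>The radius \<open>r + B\<close> is that of a ball containing
    \<open>(fst x, a2)\<close> and \<open>(fst y, a2)\<close>, the pairs compared below: the
    acceleration \<open>a2\<close> has norm at most \<open>B\<close>.\<close>
  obtain M where M: "M \<ge> 0" "\<And>x y. norm x \<le> r + B \<Longrightarrow> norm y \<le> r + B \<Longrightarrow>
      norm (g (fst x) *v snd x - g (fst y) *v snd y) \<le> M * norm (x - y)"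
    by (rule lipschitz_on_ballsE[OF lipschitz_metric_mult, where r = "r + B"]) blast
  have "norm (acceleration (fst x) (snd x) - acceleration (fst y) (snd y)) \<le> (L + M) * norm (x - y)"
    if xy: "norm x \<le> r" "norm y \<le> r" for x y
  proof -
    define a1 a2 where "a1 = acceleration (fst x) (snd x)" and "a2 = acceleration (fst y) (snd y)"
    have "norm a2 \<le> norm (g (fst y) *v a2)" by (rule norm_le_metric)
    also have "\<dots> \<le> B" using ga[of y] B(2)[OF xy(2)] by (simp add: a2_def)
    finally have a2: "norm a2 \<le> B" .
    have "norm (fst z, a2) \<le> r + B" if "norm z \<le> r" for z :: "(real^'n) \<times> (real^'n)"
      using norm_Pair_le[of "fst z" a2] norm_fst_le[of "fst z" "snd z"] that a2 by simp
    then have "norm (g (fst y) *v a2 - g (fst x) *v a2) \<le> M * norm ((fst y, a2) - (fst x, a2))"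
      using M(2)[of "(fst y, a2)" "(fst x, a2)"] xy by simp
    also have "norm ((fst y, a2) - (fst x, a2)) = norm (fst (x - y))"
      by (simp add: norm_minus_commute)
    also have "M * \<dots> \<le> M * norm (x - y)"
      using norm_fst_le[of "fst (x - y)" "snd (x - y)"]
      by (intro mult_left_mono M(1)) (simp only: prod.collapse)
    finally have 1: "norm (g (fst y) *v a2 - g (fst x) *v a2) \<le> M * norm (x - y)" .
    have "norm (a1 - a2) \<le> norm (g (fst x) *v (a1 - a2))" by (rule norm_le_metric)
    \<comment> \<open>The difference splits into the change of the right-hand side \<open>b\<close>
      and the change of the metric applied to the fixed vector \<open>a2\<close>.\<close>
    also have "g (fst x) *v (a1 - a2) = - (b x - b y) + (g (fst y) *v a2 - g (fst x) *v a2)"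
      using ga[of x] ga[of y] by (simp add: a1_def a2_def matrix_vector_mult_diff_distrib)
    also have "norm \<dots> \<le> L * norm (x - y) + M * norm (x - y)"
      using L(2)[OF xy] 1 by (intro norm_triangle_le add_mono) (simp_all add: norm_minus_commute)
    finally show ?thesis by (simp add: a1_def a2_def algebra_simps)
  qed
  then show "\<exists>L. \<forall>x y. norm x \<le> r \<longrightarrow> norm y \<le> r \<longrightarrow>
      norm (acceleration (fst x) (snd x) - acceleration (fst y) (snd y)) \<le> L * norm (x - y)" by blast
qed

lemma lipschitz_phase_field: "\<exists>L. L-lipschitz_on (cball 0 r) phase_field"
proof -
  obtain L where L: "L-lipschitz_on (cball 0 r) (\<lambda>z. acceleration (fst z) (snd z))"
    using lipschitz_acceleration lipschitz_on_balls_def by blast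
  have "lipschitz_on_balls (\<lambda>z::(real^'n) \<times> (real^'n). snd z)"
    by (intro lipschitz_on_balls_bounded_linear bounded_linear_snd)
  then obtain M where M: "M-lipschitz_on (cball 0 r) (\<lambda>z::(real^'n) \<times> (real^'n). snd z)"
    using lipschitz_on_balls_def by blast
  show ?thesis
    unfolding phase_field_def by (rule exI, rule lipschitz_on_Pair[OF M L])
qed

section \<open>A-priori bound and exponential decay\<close>

lemma energy_coercive:
  assumes "\<And>u. \<kappa> * (norm u)\<^sup>2 \<le> u \<bullet> (K *v u)" "\<kappa> > 0"
  shows "(norm v)\<^sup>2 \<le> 2 * energy x v" "\<kappa> * (norm (x - xstar))\<^sup>2 \<le> 2 * energy x v"
proof -
  have "(norm v)\<^sup>2 \<le> v \<bullet> (g x *v v)" using metric_ge[of v x] by (simp add: dot_square_norm)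
  moreover have "\<kappa> * (norm (x - xstar))\<^sup>2 \<le> (x - xstar) \<bullet> (K *v (x - xstar))" using assms by blast
  moreover have "0 \<le> v \<bullet> (g x *v v)" using metric_ge[of v x] inner_ge_zero order_trans by blast
  moreover have "0 \<le> \<kappa> * (norm (x - xstar))\<^sup>2" using assms by simp
  moreover have "2 * energy x v = v \<bullet> (g x *v v) + (x - xstar) \<bullet> (K *v (x - xstar))"
    by (simp add: energy_def)
  ultimately show "(norm v)\<^sup>2 \<le> 2 * energy x v" "\<kappa> * (norm (x - xstar))\<^sup>2 \<le> 2 * energy x v"
    by simp_all
qed

lemma phase_field_components:
  assumes "(z has_vector_derivative phase_field (z t)) (at t within S)"
  shows "((\<lambda>t. fst (z t)) has_vector_derivative snd (z t)) (at t within S)"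
    and "((\<lambda>t. snd (z t)) has_vector_derivative acceleration (fst (z t)) (snd (z t))) (at t within S)"
  using bounded_linear.has_vector_derivative[OF bounded_linear_fst assms]
    bounded_linear.has_vector_derivative[OF bounded_linear_snd assms]
  by (simp_all add: phase_field_def)

text \<open>Damping never increases the energy, and the energy controls both components; the
  resulting bound depends only on the initial state, not on \<open>T\<close>.\<close>

lemma phase_field_solution_bounded:
  obtains R where "\<And>T z. 0 \<le> T \<Longrightarrow> z 0 = z0 \<Longrightarrow>
    (\<And>t. t \<in> {0..T} \<Longrightarrow> (z has_vector_derivative phase_field (z t)) (at t within {0..T})) \<Longrightarrow> norm (z T) \<le> R"
proof -
  obtain \<kappa> where \<kappa>: "\<kappa> > 0" "\<And>u. \<kappa> * (norm u)\<^sup>2 \<le> u \<bullet> (K *v u)"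
    by (rule sym_pos_def_coercive[OF K]) blast
  define E where "E = energy (fst z0) (snd z0)"
  have "norm (z T) \<le> norm xstar + sqrt (2 * E / \<kappa>) + sqrt (2 * E)"
    if T: "0 \<le> T" and "z 0 = z0"
      and z: "\<And>t. t \<in> {0..T} \<Longrightarrow> (z has_vector_derivative phase_field (z t)) (at t within {0..T})" for T z
  proof -
    have "v \<bullet> (D *v v) \<ge> 0" for v
      using D by (cases "v = 0") (auto simp: sym_pos_def_def less_imp_le)
    then have "energy (fst (z T)) (snd (z T)) \<le> energy (fst (z 0)) (snd (z 0))"
      by (intro nonincreasing_if_derivative_nonpos_within[OF T energy_has_vector_derivative])
        (use phase_field_components[OF z] in auto)
    then have ET: "energy (fst (z T)) (snd (z T)) \<le> E" using \<open>z 0 = z0\<close> by (simp add: E_def)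
    have "(norm (snd (z T)))\<^sup>2 \<le> 2 * E"
      using energy_coercive(1)[OF \<kappa>(2,1), of "snd (z T)" "fst (z T)"] ET by linarith
    then have v: "norm (snd (z T)) \<le> sqrt (2 * E)" by (rule real_le_rsqrt)
    have "\<kappa> * (norm (fst (z T) - xstar))\<^sup>2 \<le> 2 * E"
      using energy_coercive(2)[OF \<kappa>(2,1), of "fst (z T)" "snd (z T)"] ET by linarith
    then have "(norm (fst (z T) - xstar))\<^sup>2 \<le> 2 * E / \<kappa>"
      using \<kappa>(1) by (simp add: pos_le_divide_eq mult.commute)
    then have "norm (fst (z T) - xstar) \<le> sqrt (2 * E / \<kappa>)" by (rule real_le_rsqrt)
    then show ?thesis
      using v norm_Pair_le[of "fst (z T)" "snd (z T)"] norm_triangle_ineq2[of "fst (z T)" xstar] by simp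
  qed
  then show thesis by (rule that)
qed

text \<open>The strict Lyapunov function \<open>W\<close> satisfies \<open>W' \<le> - l * W\<close>,
  so \<open>W\<close> times \<open>exp (l * t)\<close> cannot increase; since \<open>W\<close>
  dominates the squared distance to \<open>xstar\<close>, the position converges
  exponentially.\<close>

lemma phase_field_solution_tendsto:
  assumes z: "\<And>t. 0 \<le> t \<Longrightarrow> (z has_vector_derivative phase_field (z t)) (at t within {0..})"
  shows "((\<lambda>t. norm (fst (z t) - xstar)) \<longlongrightarrow> 0) at_top"
proof -
  define x v where "x = (\<lambda>t. fst (z t))" and "v = (\<lambda>t. snd (z t))"
  have zI: "(z has_vector_derivative phase_field (z t)) (at t within {0..T})" if "t \<in> {0..T}" for t T
    by (rule has_vector_derivative_within_subset[OF z]) (use that in auto)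
  obtain R where "\<And>T y. 0 \<le> T \<Longrightarrow> y 0 = z 0 \<Longrightarrow>
    (\<And>t. t \<in> {0..T} \<Longrightarrow> (y has_vector_derivative phase_field (y t)) (at t within {0..T})) \<Longrightarrow> norm (y T) \<le> R"
    by (rule phase_field_solution_bounded[of "z 0"]) blast
  then have "norm (z t) \<le> R" if "0 \<le> t" for t using that zI by blast
  then have R: "norm (x t, v t) \<le> R" if "0 \<le> t" for t using that by (simp add: x_def v_def)

  obtain \<kappa> where \<kappa>: "\<kappa> > 0" "\<And>u. \<kappa> * (norm u)\<^sup>2 \<le> u \<bullet> (K *v u)"
    by (rule sym_pos_def_coercive[OF K]) blast
  obtain \<delta> where \<delta>: "\<delta> > 0" "\<And>u. \<delta> * (norm u)\<^sup>2 \<le> u \<bullet> (D *v u)"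
    by (rule sym_pos_def_coercive[OF D]) blast
  obtain N where N: "N > 0" "\<And>u. norm (K *v u) \<le> norm u * N"
    using bounded_linear.pos_bounded[OF matrix_vector_mul_bounded_linear[of K]] by blast
  \<comment> \<open>\<open>R\<close> bounds the whole orbit, so constants valid on the ball of that
    radius serve at every time.\<close>
  obtain M where M: "M \<ge> 0" "\<And>x v. norm (x, v) \<le> R \<Longrightarrow> norm (g x *v v) \<le> M * norm v"
    by (rule linear_growth_at_zero[OF lipschitz_metric_mult, where r = R]) auto
  \<comment> \<open>\<open>h\<close> is what \<open>e\<close> is paired with in the derivative of
    the cross term, apart from \<open>- K e\<close>. It vanishes with the velocity and is therefore
    of order \<open>norm v\<close> along the orbit.\<close>
  define h where "h = (\<lambda>z. metric_deriv (fst z) (snd z) *v snd z - inertia (fst z) (snd z) - D *v snd z)"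
  have "lipschitz_on_balls h"
    unfolding h_def
    by (intro lipschitz_on_balls_diff lipschitz_metric_deriv lipschitz_inertia lipschitz_mult_snd)
  moreover have "h (x, 0) = 0" for x by (simp add: h_def inertia_def vec_eq_iff)
  ultimately obtain L where L: "L \<ge> 0" "\<And>x v. norm (x, v) \<le> R \<Longrightarrow> norm (h (x, v)) \<le> L * norm v"
    by (rule linear_growth_at_zero[where r = R]) auto
  obtain \<epsilon> l m where lm: "l > 0" "m > 0"
    and lyap: "\<And>a b vGv eKe vDv s eh. a \<ge> 0 \<Longrightarrow> b \<ge> 0 \<Longrightarrow> a\<^sup>2 \<le> vGv \<Longrightarrow> vGv \<le> M * a\<^sup>2 \<Longrightarrow> \<kappa> * b\<^sup>2 \<le> eKe \<Longrightarrow>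
      eKe \<le> N * b\<^sup>2 \<Longrightarrow> \<delta> * a\<^sup>2 \<le> vDv \<Longrightarrow> \<bar>s\<bar> \<le> M * (a * b) \<Longrightarrow> eh \<le> L * (a * b) \<Longrightarrow>
      m * b\<^sup>2 \<le> 1/2 * vGv + 1/2 * eKe + \<epsilon> * s \<and>
      - vDv + \<epsilon> * (vGv - eKe + eh) \<le> - l * (1/2 * vGv + 1/2 * eKe + \<epsilon> * s)"
    by (rule strict_lyapunov_constants[OF \<delta>(1) \<kappa>(1) L(1) M(1) less_imp_le[OF N(1)]], rule that)
  define W where "W = (\<lambda>t. energy (x t) (v t) + \<epsilon> * cross_term (x t) (v t))"
  define W' where "W' = (\<lambda>t. - (v t \<bullet> (D *v v t)) + \<epsilon> *
     (v t \<bullet> (g (x t) *v v t) - (x t - xstar) \<bullet> (K *v (x t - xstar)) + (x t - xstar) \<bullet> h (x t, v t)))"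
  have W: "m * (norm (x t - xstar))\<^sup>2 \<le> W t \<and> W' t \<le> - l * W t" if t: "0 \<le> t" for t
    unfolding W_def W'_def energy_def cross_term_def
  proof (rule lyap)
    note cs = norm_cauchy_schwarz[THEN order_trans] Cauchy_Schwarz_ineq2[THEN order_trans]
    show "(norm (v t))\<^sup>2 \<le> v t \<bullet> (g (x t) *v v t)"
      using metric_ge[of "v t" "x t"] by (simp add: dot_square_norm)
    show "v t \<bullet> (g (x t) *v v t) \<le> M * (norm (v t))\<^sup>2"
      using mult_left_mono[OF M(2)[OF R[OF t]], of "norm (v t)"]
      by (intro cs) (simp add: power2_eq_square mult_ac)
    show "(x t - xstar) \<bullet> (K *v (x t - xstar)) \<le> N * (norm (x t - xstar))\<^sup>2"
      using mult_left_mono[OF N(2)[of "x t - xstar"], of "norm (x t - xstar)"]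
      by (intro cs) (simp add: power2_eq_square mult_ac)
    show "\<bar>(x t - xstar) \<bullet> (g (x t) *v v t)\<bar> \<le> M * (norm (v t) * norm (x t - xstar))"
      using mult_left_mono[OF M(2)[OF R[OF t]], of "norm (x t - xstar)"]
      by (intro cs) (simp add: mult_ac)
    show "(x t - xstar) \<bullet> h (x t, v t) \<le> L * (norm (v t) * norm (x t - xstar))"
      using mult_left_mono[OF L(2)[OF R[OF t]], of "norm (x t - xstar)"]
      by (intro cs) (simp add: mult_ac)
  qed (use \<kappa> \<delta> in auto)
  have decay: "m * (norm (x T - xstar))\<^sup>2 \<le> W 0 * exp (- l * T)" if T: "0 \<le> T" for T
  proof -
    have "W T * exp (l * T) \<le> W 0 * exp (l * 0)"
    proof (rule nonincreasing_if_derivative_nonpos_within[OF T])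
      fix t assume t: "t \<in> {0..T}"
      have x: "(x has_vector_derivative v t) (at t within {0..T})"
        and v: "(v has_vector_derivative acceleration (x t) (v t)) (at t within {0..T})"
        using phase_field_components[OF zI[OF t]] by (simp_all add: x_def v_def)
      have "(W has_vector_derivative W' t) (at t within {0..T})"
        unfolding W_def W'_def h_def fst_conv snd_conv
        by (intro has_vector_derivative_add has_vector_derivative_mult_right
            energy_has_vector_derivative cross_term_has_vector_derivative x v)
      moreover have "((\<lambda>t. exp (l * t)) has_vector_derivative (l * exp (l * t))) (at t within {0..T})"
        by (auto simp flip: has_real_derivative_iff_has_vector_derivative intro!: derivative_eq_intros)
      ultimately show "((\<lambda>t. W t * exp (l * t)) has_vector_derivative
          (W t * (l * exp (l * t)) + W' t * exp (l * t))) (at t within {0..T})"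
        by (rule has_vector_derivative_mult)
      have "(W' t + l * W t) * exp (l * t) \<le> 0"
        using W[of t] t by (intro mult_nonpos_nonneg) auto
      then show "W t * (l * exp (l * t)) + W' t * exp (l * t) \<le> 0" by (simp add: algebra_simps)
    qed
    then have "W T \<le> W 0 * exp (- l * T)"
      by (simp add: exp_minus field_simps)
    then show ?thesis using W[OF T] by linarith
  qed
  have "LIM t at_top. l * t :> at_top"
    by (rule filterlim_tendsto_pos_mult_at_top[OF tendsto_const lm(1) filterlim_ident])
  then have "LIM t at_top. - l * t :> at_bot" by (simp add: filterlim_uminus_at_bot)
  then have lim: "((\<lambda>t. sqrt (W 0 / m * exp (- l * t))) \<longlongrightarrow> sqrt (W 0 / m * 0)) at_top"
    by (intro tendsto_intros filterlim_compose[OF exp_at_bot])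
  show ?thesis
  proof (rule tendsto_sandwich[of "\<lambda>_. 0"])
    have "norm (x t - xstar) \<le> sqrt (W 0 / m * exp (- l * t))" if "0 \<le> t" for t
      using decay[OF that] lm by (intro real_le_rsqrt) (simp add: field_simps)
    then show "\<forall>\<^sub>F t in at_top. norm (fst (z t) - xstar) \<le> sqrt (W 0 / m * exp (- l * t))"
      unfolding x_def eventually_at_top_linorder by blast
  qed (use lim in auto)
qed

theorem acceleration_globally_asymptotically_stable: "globally_asymptotically_stable acceleration xstar"
  unfolding globally_asymptotically_stable_def
proof (intro allI)
  fix x0 v0
  obtain R where R: "\<And>T z. 0 \<le> T \<Longrightarrow> z 0 = (x0, v0) \<Longrightarrow>
    (\<And>t. t \<in> {0..T} \<Longrightarrow> (z has_vector_derivative phase_field (z t)) (at t within {0..T})) \<Longrightarrow> norm (z T) \<le> R"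
    by (rule phase_field_solution_bounded[of "(x0, v0)"]) blast
  obtain z where z0: "z 0 = (x0, v0)"
    and z: "\<forall>t\<ge>0. (z has_vector_derivative phase_field (z t)) (at t within {0..})"
    and unique: "\<forall>T y. y 0 = (x0, v0) \<longrightarrow>
      (\<forall>t\<in>{0..<T}. (y has_vector_derivative phase_field (y t)) (at t within {0..<T})) \<longrightarrow>
      (\<forall>t\<in>{0..<T}. y t = z t)"
  proof (rule ode_global_solution_if_bounded[where f = phase_field and R = R and ?z0.0 = "(x0, v0)"])
    show "\<exists>L. L-lipschitz_on (cball 0 r) phase_field" for r by (rule lipschitz_phase_field)
    show "norm (z T) \<le> R" if "0 \<le> T" "z 0 = (x0, v0)"
      "\<And>t. t \<in> {0..T} \<Longrightarrow> (z has_vector_derivative phase_field (z t)) (at t within {0..T})" for T z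
      using that by (rule R)
  qed (rule that)
  show "\<exists>x. second_order_solution acceleration {0..} x0 v0 x \<and>
      (\<forall>T>0. \<forall>y. second_order_solution acceleration {0..<T} x0 v0 y \<longrightarrow> (\<forall>t\<in>{0..<T}. y t = x t)) \<and>
      ((\<lambda>t. norm (x t - xstar)) \<longlongrightarrow> 0) at_top"
  proof (intro exI[of _ "\<lambda>t. fst (z t)"] conjI allI impI ballI)
    show "second_order_solution acceleration {0..} x0 v0 (\<lambda>t. fst (z t))"
      unfolding second_order_solution_def
      by (intro exI[of _ "\<lambda>t. snd (z t)"]) (use phase_field_components[OF z[rule_format]] z0 in auto)
    show "((\<lambda>t. norm (fst (z t) - xstar)) \<longlongrightarrow> 0) at_top"
      by (rule phase_field_solution_tendsto[OF z[rule_format]])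
    fix T t y
    assume "second_order_solution acceleration {0..<T} x0 v0 y" and t: "t \<in> {0..<T}"
    then obtain u where u: "y 0 = x0" "u 0 = v0"
      "\<And>t. t \<in> {0..<T} \<Longrightarrow> (y has_vector_derivative u t) (at t within {0..<T})"
      "\<And>t. t \<in> {0..<T} \<Longrightarrow> (u has_vector_derivative acceleration (y t) (u t)) (at t within {0..<T})"
      unfolding second_order_solution_def by blast
    \<comment> \<open>Together with its velocity \<open>u\<close>, the competing motion solves the
      first-order system, where uniqueness is available.\<close>
    have "(y t, u t) = z t"
      by (rule unique[rule_format, of "\<lambda>t. (y t, u t)" T t])
        (use u t in \<open>auto simp: phase_field_def intro: has_vector_derivative_Pair\<close>)
    then show "y t = fst (z t)" by (metis fst_conv)
  qed
qed

end

subsection \<open>The graph metric\<close>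

lemma smooth_partial_deriv: "smooth f \<Longrightarrow> smooth (partial_deriv i f)"
  unfolding smooth_def by (metis k_times_cont_diff.simps(2))

lemma smooth_differentiable: "smooth f \<Longrightarrow> f differentiable (at x)"
  unfolding smooth_def by (metis k_times_cont_diff.simps(2))

lemma smooth_continuous: "smooth f \<Longrightarrow> continuous_on UNIV f"
  unfolding smooth_def by (metis k_times_cont_diff.simps(1))

lemma smooth_lipschitz_on_balls: "smooth f \<Longrightarrow> lipschitz_on_balls f"
  by (rule lipschitz_on_balls_if_continuous_partial_deriv)
    (auto intro: smooth_differentiable smooth_continuous smooth_partial_deriv)

text \<open>The rank-one form makes \<open>v . G v\<close> the sum of \<open>v . v\<close> and the
  square of \<open>grad f x . v\<close>, whence the domination of the Euclidean metric.\<close>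

lemma graph_metric_mult: "graph_metric f x *v v = v + (grad f x \<bullet> v) *\<^sub>R grad f x"
proof (simp only: vec_eq_iff, intro allI)
  fix i
  have "(graph_metric f x *v v) $ i
      = (\<Sum>j\<in>UNIV. (if i = j then v $ j else 0) + grad f x $ i * (grad f x $ j * v $ j))"
    unfolding matrix_vector_mult_def vec_lambda_beta
    by (intro sum.cong) (auto simp: graph_metric_nth grad_def algebra_simps)
  then show "(graph_metric f x *v v) $ i = (v + (grad f x \<bullet> v) *\<^sub>R grad f x) $ i"
    by (simp add: sum.distrib inner_vec_def mult.commute flip: sum_distrib_left)
qed

lemma damped_geodesic_system_graph_metric:
  assumes "sym_pos_def K" "sym_pos_def D" "smooth f"
  shows "damped_geodesic_system (graph_metric f) K D"
proof
  fix x v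
  show "transpose (graph_metric f x) = graph_metric f x"
    by (simp add: vec_eq_iff transpose_def graph_metric_nth mult.commute)
  show "v \<bullet> v \<le> v \<bullet> (graph_metric f x *v v)"
    by (simp add: graph_metric_mult inner_add_right inner_commute)
  fix i j k
  note smooth1 = smooth_partial_deriv[OF assms(3)]
  note diff = smooth_differentiable[OF smooth1]
  \<comment> \<open>The derivatives of the metric contain second partial derivatives of
    \<open>f\<close>; these are Lipschitz on balls because third derivatives are continuous.\<close>
  note lip = smooth_lipschitz_on_balls[OF smooth1]
    smooth_lipschitz_on_balls[OF smooth_partial_deriv[OF smooth1]]
  have prod: "(\<lambda>y. partial_deriv i f y * partial_deriv j f y) differentiable (at x)" for x
    by (intro differentiable_mult diff)
  then show "(\<lambda>y. graph_metric f y $ i $ j) differentiable (at x)"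
    unfolding graph_metric_nth by (intro differentiable_add differentiable_const)
  have "partial_deriv k (\<lambda>y. graph_metric f y $ i $ j) =
      (\<lambda>x. partial_deriv k (partial_deriv i f) x * partial_deriv j f x
        + partial_deriv i f x * partial_deriv k (partial_deriv j f) x)"
    by (simp add: graph_metric_nth partial_deriv_const_add partial_deriv_mult diff fun_eq_iff)
  then show "lipschitz_on_balls (partial_deriv k (\<lambda>y. graph_metric f y $ i $ j))"
    by (simp only:) (intro lipschitz_on_balls_add lipschitz_on_balls_mult lip)
qed (use assms in auto)

theorem theorem1:
  fixes xstar :: "real^'d::finite"
    and K D :: "real^'d^'d"
    and \<psi> :: "real^'d \<Rightarrow> real^'p::finite \<Rightarrow> real"
    and w :: "real^'p"
  assumes "sym_pos_def K"
    and "sym_pos_def D"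
    and "\<And>w. smooth (\<lambda>x. \<psi> x w)"
  shows "globally_asymptotically_stable (accel K D xstar (\<lambda>x. \<psi> x w)) xstar"
proof -
  interpret damped_geodesic_system "graph_metric (\<lambda>x. \<psi> x w)" K D xstar
    using assms by (rule damped_geodesic_system_graph_metric)
  have "acceleration = accel K D xstar (\<lambda>x. \<psi> x w)"
    by (simp add: acceleration_def force_def accel_def fun_eq_iff)
  then show ?thesis using acceleration_globally_asymptotically_stable by simp
qed

end
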